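(* Let $k=-3/2$. There is a non-trivial homomorphism of vertex superalgebras $$\overline\Phi: V^k(osp(1,2))\rightarrow V^{ns}_{crit}\otimes F\otimes\Pi^{1/2}(0)$$ such that $T$ is a central element of $V^k(osp(1,2))$; that is, $T\otimes\mathbf 1\otimes\mathbf 1$ lies in the image of $\overline\Phi$ and is central there.
   Context: $V^k(\mathfrak g)$ is the universal affine vertex superalgebra of level $k$. $osp(1,2)$ is the Lie superalgebra with even basis $e,f,h$, odd basis $x,y$, relations $[e,f]=h$, $[h,e]=2e$, $[h,f]=-2f$, $[h,x]=x$, $[e,x]=0$, $[f,x]=-y$, $[h,y]=-y$, $[e,y]=-x$, $[f,y]=0$, $\{x,x\}=2e$, $\{x,y\}=h$, $\{y,y\}=-2f$, and invariant form with non-trivial products $(e,f)=(f,e)=1$, $(h,h)=2$, $(x,y)=-(y,x)=2$. (Level $k=-3/2$ is the critical level.) $V^{ns}_{crit}$ is the vertex superalgebra freely generated by an odd field $G^{cri}$ and an even field $T$ such that $T$ is central and $[G^{cri}{}_\lambda G^{cri}]=2T-\lambda^2$. $F$ is the fermionic vertex superalgebra generated by one odd field $\Psi(z)=\sum_{m\in\mathbb Z}\Psi(m+\frac12)z^{-m-1}$ with $\{\Psi(r),\Psi(s)\}=\delta_{r+s,0}$. Let $\langle c,c\rangle=\langle d,d\rangle=0$, $\langle c,d\rangle=2$, and let $M(1)$ be the rank two Heisenberg vertex algebra generated by $c(z),d(z)$ with $[a(m),b(n)]=m\langle a,b\rangle\delta_{m+n,0}$. $\Pi^{1/2}(0)=M(1)\otimes\mathbb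 C[\mathbb Z\frac c2]$ is the lattice-type vertex algebra with the usual lattice vertex operators (trivial cocycle). An element of a vertex superalgebra is central if all modes of its field (super)commute with all modes of all fields. *)

theory Defs
  imports Complex_Main "HOL-Library.Poly_Mapping"
begin

section \<open>Vertex superalgebras\<close>

text \<open>The underlying complex vector space is a whole type, with scalar multiplication \<open>smult\<close>.
  Parities are Booleans (\<open>True\<close> is odd), and \<open>nprod V a n b\<close> is the \<open>n\<close>-th product
  \<open>a\<^sub>(\<^sub>n\<^sub>)b\<close>, so that the field of \<open>a\<close> is the sum of the \<open>a\<^sub>(\<^sub>n\<^sub>) z^(-n-1)\<close>.\<close>

record 'v vsa =
  smult :: "complex \<Rightarrow> 'v \<Rightarrow> 'v"
  part  :: "bool \<Rightarrow> 'v set"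
  vac   :: "'v"
  nprod :: "'v \<Rightarrow> int \<Rightarrow> 'v \<Rightarrow> 'v"

definition psign :: "bool \<Rightarrow> bool \<Rightarrow> complex" where
  "psign p q = (if p \<and> q then -1 else 1)"

text \<open>The last axiom is the Borcherds (Jacobi) identity. All sums in it have finite support by
  \<open>truncation\<close>. The translation operator is \<open>a \<mapsto> a\<^sub>(\<^sub>-\<^sub>2\<^sub>)1\<close>; its properties follow from
  the axioms.\<close>

locale vertex_superalgebra =
  fixes V :: "'v::ab_group_add vsa"
  assumes vector_space: "vector_space (smult V)"
    and part_subspace: "module.subspace (smult V) (part V p)"
    and part_disjoint: "part V False \<inter> part V True = {0}"
    and part_sum: "\<exists>a\<in>part V False. \<exists>b\<in>part V True. v = a + b"
    and nprod_linear_left: "Vector_Spaces.linear (smult V) (smult V) (\<lambda>a. nprod V a n b)"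
    and nprod_linear_right: "Vector_Spaces.linear (smult V) (smult V) (nprod V a n)"
    and nprod_parity: "a \<in> part V p \<Longrightarrow> b \<in> part V q \<Longrightarrow> nprod V a n b \<in> part V (p \<noteq> q)"
    and truncation: "\<exists>N. \<forall>n\<ge>N. nprod V a n b = 0"
    and vac_even: "vac V \<in> part V False"
    and vac_left: "nprod V (vac V) n b = (if n = -1 then b else 0)"
    and vac_right_nonneg: "n \<ge> 0 \<Longrightarrow> nprod V a n (vac V) = 0"
    and vac_right: "nprod V a (-1) (vac V) = a"
    and borcherds: "a \<in> part V p \<Longrightarrow> b \<in> part V q \<Longrightarrow>
      Sum_any (\<lambda>j::nat. smult V (of_int m gchoose j)
          (nprod V (nprod V a (n + int j) b) (m + k - int j) c))
    = Sum_any (\<lambda>j::nat. smult V ((-1) ^ j * (of_int n gchoose j))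
          (nprod V a (m + n - int j) (nprod V b (k + int j) c)
           - smult V ((-1) powi n * psign p q)
               (nprod V b (n + k - int j) (nprod V a (m + int j) c))))"

definition vsa_hom ::
    "'v::ab_group_add vsa \<Rightarrow> 'w::ab_group_add vsa \<Rightarrow> ('v \<Rightarrow> 'w) \<Rightarrow> bool" where
  "vsa_hom V W \<Phi> \<longleftrightarrow>
     vertex_superalgebra V \<and> vertex_superalgebra W \<and>
     Vector_Spaces.linear (smult V) (smult W) \<Phi> \<and>
     (\<forall>p. \<Phi> ` part V p \<subseteq> part W p) \<and>
     \<Phi> (vac V) = vac W \<and>
     (\<forall>a n b. \<Phi> (nprod V a n b) = nprod W (\<Phi> a) n (\<Phi> b))"

text \<open>A homomorphism is trivial if its image consists of multiples of the vacuum only. As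
  homomorphisms preserve the vacuum, merely demanding a nonzero map would say very little.\<close>

definition nontrivial_hom :: "'w::ab_group_add vsa \<Rightarrow> ('v \<Rightarrow> 'w) \<Rightarrow> bool" where
  "nontrivial_hom W \<Phi> \<longleftrightarrow> \<not> range \<Phi> \<subseteq> range (\<lambda>s. smult W s (vac W))"

text \<open>Centrality of \<open>z\<close> in a vertex subalgebra \<open>S\<close>; all modes act on \<open>S\<close>. The supercommutator
  is formed on homogeneous components.\<close>

definition central_in :: "'v::ab_group_add vsa \<Rightarrow> 'v set \<Rightarrow> 'v \<Rightarrow> bool" where
  "central_in V S z \<longleftrightarrow> z \<in> S \<and>
     (\<exists>z0. z = z0 False + z0 True \<and> (\<forall>p. z0 p \<in> part V p) \<and>
        (\<forall>p q. \<forall>a \<in> S \<inter> part V q. \<forall>v\<in>S. \<forall>m n.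
           nprod V (z0 p) m (nprod V a n v) = smult V (psign p q) (nprod V a n (nprod V (z0 p) m v))))"

inductive_set generated :: "'v::ab_group_add vsa \<Rightarrow> 'v set \<Rightarrow> 'v set"
  for V :: "'v vsa" and A :: "'v set" where
  gen_base: "a \<in> A \<Longrightarrow> a \<in> generated V A"
| gen_vac: "vac V \<in> generated V A"
| gen_add: "u \<in> generated V A \<Longrightarrow> v \<in> generated V A \<Longrightarrow> u + v \<in> generated V A"
| gen_smult: "u \<in> generated V A \<Longrightarrow> smult V s u \<in> generated V A"
| gen_nprod: "u \<in> generated V A \<Longrightarrow> v \<in> generated V A \<Longrightarrow> nprod V u n v \<in> generated V A"

text \<open>The family \<open>(b i)\<close>, \<open>i \<in> I\<close>, is a basis (as a family: no repetitions).\<close>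

definition basis_family ::
    "(complex \<Rightarrow> 'v \<Rightarrow> 'v::ab_group_add) \<Rightarrow> 'i set \<Rightarrow> ('i \<Rightarrow> 'v) \<Rightarrow> bool" where
  "basis_family s I b \<longleftrightarrow> inj_on b I \<and> \<not> module.dependent s (b ` I) \<and> module.span s (b ` I) = UNIV"

text \<open>The coefficient of \<open>\<lambda>^j\<close> in the bracket \<open>[a\<^sub>\<lambda> b]\<close>.\<close>

definition lambda_bracket :: "'v vsa \<Rightarrow> 'v \<Rightarrow> 'v \<Rightarrow> nat \<Rightarrow> 'v" where
  "lambda_bracket V a b j = smult V (1 / fact j) (nprod V a (int j) b)"

text \<open>Free generation by a finite list of (parity, vector) pairs: the ordered monomials in the
  modes \<open>a\<^sub>(\<^sub>-\<^sub>n\<^sub>-\<^sub>1\<^sub>)\<close>, \<open>n \<ge> 0\<close>, applied to the vacuum form a basis, where the modes of odd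
  generators are not repeated.\<close>

definition pbw_words :: "(bool \<times> 'v) list \<Rightarrow> (nat \<times> nat) list set" where
  "pbw_words gs = {w. (\<forall>(i, n) \<in> set w. i < length gs) \<and>
     sorted_wrt (\<lambda>(i, m) (j, n). i < j \<or> i = j \<and> (m < n \<or> m = n \<and> \<not> fst (gs ! i))) w}"

definition pbw_monomial :: "'v vsa \<Rightarrow> (bool \<times> 'v) list \<Rightarrow> (nat \<times> nat) list \<Rightarrow> 'v" where
  "pbw_monomial V gs w = foldr (\<lambda>(i, n). nprod V (snd (gs ! i)) (- int n - 1)) w (vac V)"

definition freely_generated :: "'v::ab_group_add vsa \<Rightarrow> (bool \<times> 'v) list \<Rightarrow> bool" where
  "freely_generated V gs \<longleftrightarrow> vertex_superalgebra V \<and>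
     (\<forall>(p, a) \<in> set gs. a \<in> part V p) \<and>
     basis_family (smult V) (pbw_words gs) (pbw_monomial V gs)"


section \<open>Tensor products\<close>

definition tensor_space ::
    "(complex \<Rightarrow> 'a \<Rightarrow> 'a::ab_group_add) \<Rightarrow> (complex \<Rightarrow> 'b \<Rightarrow> 'b::ab_group_add) \<Rightarrow>
     (complex \<Rightarrow> 'w \<Rightarrow> 'w::ab_group_add) \<Rightarrow> ('a \<Rightarrow> 'b \<Rightarrow> 'w) \<Rightarrow> bool" where
  "tensor_space s1 s2 s t \<longleftrightarrow>
     (\<forall>b. Vector_Spaces.linear s1 s (\<lambda>a. t a b)) \<and> (\<forall>a. Vector_Spaces.linear s2 s (t a)) \<and>
     (\<forall>A B. basis_family s1 A id \<and> basis_family s2 B id \<longrightarrow>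
        basis_family s (A \<times> B) (\<lambda>(a, b). t a b))"

text \<open>\<open>W\<close>, with the bilinear map \<open>t\<close>, is the tensor product of \<open>V1\<close> and \<open>V2\<close>. The field of
  \<open>a \<otimes> b\<close> is \<open>Y(a,z) \<otimes> Y(b,z)\<close>, with the sign rule
  \<open>(A \<otimes> B)(u \<otimes> v) = (-1)^(|B||u|) Au \<otimes> Bv\<close>.\<close>

definition tensor_product ::
    "'a::ab_group_add vsa \<Rightarrow> 'b::ab_group_add vsa \<Rightarrow> 'w::ab_group_add vsa \<Rightarrow>
     ('a \<Rightarrow> 'b \<Rightarrow> 'w) \<Rightarrow> bool" where
  "tensor_product V1 V2 W t \<longleftrightarrow> vertex_superalgebra W \<and>
     tensor_space (smult V1) (smult V2) (smult W) t \<and>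
     vac W = t (vac V1) (vac V2) \<and>
     (\<forall>p q. \<forall>a \<in> part V1 p. \<forall>b \<in> part V2 q. t a b \<in> part W (p \<noteq> q)) \<and>
     (\<forall>p q a b u v n. b \<in> part V2 p \<longrightarrow> u \<in> part V1 q \<longrightarrow>
        nprod W (t a b) n (t u v) =
        smult W (psign p q) (Sum_any (\<lambda>j::int. t (nprod V1 a j u) (nprod V2 b (n - 1 - j) v))))"


section \<open>Universal affine vertex superalgebras\<close>

text \<open>A Lie superalgebra with invariant form is given on a finite homogeneous basis: parity
  \<open>par\<close>, structure constants \<open>br a b c\<close> (the coefficient of \<open>c\<close> in \<open>[a,b]\<close>) and \<open>form\<close>.
  A word \<open>[(a1,n1),\<dots>,(ar,nr)]\<close> stands for the monomial \<open>a1(n1) \<cdots> ar(nr)\<close> in the free algebra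
  on the modes \<open>a(n) = a \<otimes> t^n\<close> of the affine Lie superalgebra \<open>L = g[t,t^-1] + \<complex>K\<close>.\<close>

definition pscale :: "complex \<Rightarrow> ('w \<Rightarrow>\<^sub>0 complex) \<Rightarrow> ('w \<Rightarrow>\<^sub>0 complex)" where
  "pscale s = Poly_Mapping.map ((*) s)"

abbreviation word :: "'w \<Rightarrow> ('w \<Rightarrow>\<^sub>0 complex)" where
  "word w \<equiv> Poly_Mapping.single w 1"

text \<open>The free algebra modulo the span of these elements is
  the \<open>L\<close>-module induced from the one-dimensional module of \<open>g[t] + \<complex>K\<close> on which \<open>g[t]\<close>
  acts by zero and \<open>K\<close> by \<open>k\<close>: first the relations
  \<open>[a(m),b(n)] = [a,b](m+n) + m \<delta>\<^bsub>m+n,0\<^esub> (a,b) K\<close> with \<open>K = k\<close>, then \<open>a(n) \<cdot> 1 = 0\<close> for \<open>n \<ge> 0\<close>.\<close>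

definition affine_relations ::
    "('g::finite \<Rightarrow> bool) \<Rightarrow> ('g \<Rightarrow> 'g \<Rightarrow> 'g \<Rightarrow> complex) \<Rightarrow> ('g \<Rightarrow> 'g \<Rightarrow> complex) \<Rightarrow> complex \<Rightarrow>
     (('g \<times> int) list \<Rightarrow>\<^sub>0 complex) set" where
  "affine_relations par br form k =
     {word (u @ [(a, m), (b, n)] @ w)
        - pscale (psign (par a) (par b)) (word (u @ [(b, n), (a, m)] @ w))
        - (\<Sum>c\<in>UNIV. pscale (br a b c) (word (u @ [(c, m + n)] @ w)))
        - pscale (if m + n = 0 then of_int m * form a b * k else 0) (word (u @ w))
      | u a m b n w. True}
     \<union> {word (u @ [(a, n)]) | u a n. n \<ge> 0}"

definition word_action :: "'v::ab_group_add vsa \<Rightarrow> ('g \<Rightarrow> 'v) \<Rightarrow> (('g \<times> int) list \<Rightarrow>\<^sub>0 complex) \<Rightarrow> 'v" where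
  "word_action V J p = (\<Sum>w\<in>Poly_Mapping.keys p.
     smult V (Poly_Mapping.lookup p w) (foldr (\<lambda>(a, n). nprod V (J a) n) w (vac V)))"

text \<open>\<open>V\<close> is the universal affine vertex superalgebra of level \<open>k\<close>, where the field of \<open>J a\<close> is
  \<open>a(z)\<close>: the canonical map from the free algebra onto \<open>V\<close> induces an isomorphism from the
  module above onto \<open>V\<close>.\<close>

definition universal_affine ::
    "('g::finite \<Rightarrow> bool) \<Rightarrow> ('g \<Rightarrow> 'g \<Rightarrow> 'g \<Rightarrow> complex) \<Rightarrow> ('g \<Rightarrow> 'g \<Rightarrow> complex) \<Rightarrow> complex \<Rightarrow>
     'v::ab_group_add vsa \<Rightarrow> ('g \<Rightarrow> 'v) \<Rightarrow> bool" where
  "universal_affine par br form k V J \<longleftrightarrow> vertex_superalgebra V \<and>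
     (\<forall>a. J a \<in> part V (par a)) \<and>
     range (word_action V J) = UNIV \<and>
     {p. word_action V J p = 0} = module.span pscale (affine_relations par br form k)"

datatype osp = Oe | Of | Oh | Ox | Oy

instance osp :: finite
proof
  have "(UNIV :: osp set) = {Oe, Of, Oh, Ox, Oy}"
    using osp.exhaust by blast
  then show "finite (UNIV :: osp set)"
    by (metis finite.emptyI finite_insert)
qed

fun osp_odd :: "osp \<Rightarrow> bool" where
  "osp_odd Ox = True"
| "osp_odd Oy = True"
| "osp_odd _ = False"

abbreviation osp_multiple :: "complex \<Rightarrow> osp \<Rightarrow> (osp \<Rightarrow> complex)" where
  "osp_multiple s a \<equiv> (\<lambda>c. if c = a then s else 0)"

fun osp_bracket :: "osp \<Rightarrow> osp \<Rightarrow> osp \<Rightarrow> complex" where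
  "osp_bracket Oe Of = osp_multiple 1 Oh"
| "osp_bracket Of Oe = osp_multiple (-1) Oh"
| "osp_bracket Oh Oe = osp_multiple 2 Oe"
| "osp_bracket Oe Oh = osp_multiple (-2) Oe"
| "osp_bracket Oh Of = osp_multiple (-2) Of"
| "osp_bracket Of Oh = osp_multiple 2 Of"
| "osp_bracket Oh Ox = osp_multiple 1 Ox"
| "osp_bracket Ox Oh = osp_multiple (-1) Ox"
| "osp_bracket Of Ox = osp_multiple (-1) Oy"
| "osp_bracket Ox Of = osp_multiple 1 Oy"
| "osp_bracket Oh Oy = osp_multiple (-1) Oy"
| "osp_bracket Oy Oh = osp_multiple 1 Oy"
| "osp_bracket Oe Oy = osp_multiple (-1) Ox"
| "osp_bracket Oy Oe = osp_multiple 1 Ox"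
| "osp_bracket Ox Ox = osp_multiple 2 Oe"
| "osp_bracket Ox Oy = osp_multiple 1 Oh"
| "osp_bracket Oy Ox = osp_multiple 1 Oh"
| "osp_bracket Oy Oy = osp_multiple (-2) Of"
| "osp_bracket _ _ = (\<lambda>_. 0)"

fun osp_form :: "osp \<Rightarrow> osp \<Rightarrow> complex" where
  "osp_form Oe Of = 1"
| "osp_form Of Oe = 1"
| "osp_form Oh Oh = 2"
| "osp_form Ox Oy = 2"
| "osp_form Oy Ox = -2"
| "osp_form _ _ = 0"


section \<open>The factors of the target\<close>

definition is_Vns_crit :: "'v::ab_group_add vsa \<Rightarrow> 'v \<Rightarrow> 'v \<Rightarrow> bool" where
  "is_Vns_crit N G T \<longleftrightarrow> freely_generated N [(True, G), (False, T)] \<and>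
     central_in N UNIV T \<and>
     lambda_bracket N G G = (\<lambda>j. if j = 0 then smult N 2 T
                                 else if j = 2 then smult N (-1) (vac N) else 0)"

text \<open>Since \<open>\<Psi>(m + 1/2)\<close> is the \<open>m\<close>-th mode, \<open>{\<Psi>(r),\<Psi>(s)} = \<delta>\<^bsub>r+s,0\<^esub>\<close> becomes a condition on
  \<open>m + n + 1\<close>. The zero space is excluded.\<close>

definition is_fermionic :: "'v::ab_group_add vsa \<Rightarrow> 'v \<Rightarrow> bool" where
  "is_fermionic F \<Psi> \<longleftrightarrow> vertex_superalgebra F \<and> vac F \<noteq> 0 \<and>
     \<Psi> \<in> part F True \<and> generated F {\<Psi>} = UNIV \<and>
     (\<forall>m n v. nprod F \<Psi> m (nprod F \<Psi> n v) + nprod F \<Psi> n (nprod F \<Psi> m v)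
              = (if m + n + 1 = 0 then v else 0))"

text \<open>The coefficient of \<open>z^r\<close> in \<open>exp (\<Sum>\<^bsub>n\<ge>1\<^esub> X\<^sub>n z^n)\<close>, expanded as the sum over \<open>l\<close> of the
  \<open>l\<close>-th powers divided by \<open>l!\<close>.\<close>

definition exp_coeff ::
    "(complex \<Rightarrow> 'v \<Rightarrow> 'v::ab_group_add) \<Rightarrow> (nat \<Rightarrow> 'v \<Rightarrow> 'v) \<Rightarrow> nat \<Rightarrow> 'v \<Rightarrow> 'v" where
  "exp_coeff s X r v =
     (\<Sum>ns | sum_list ns = r \<and> 0 \<notin> set ns. s (1 / fact (length ns)) (foldr X ns v))"

text \<open>The \<open>n\<close>-th mode of
  \<open>Y(e^\<alpha>,z) = exp (\<Sum>\<^bsub>j\<ge>1\<^esub> \<alpha>(-j)/j z^j) exp (- \<Sum>\<^bsub>j\<ge>1\<^esub> \<alpha>(j)/j z^(-j)) e^\<alpha> z^(\<alpha>(0))\<close>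
  for \<open>\<alpha> = m c/2\<close>, where \<open>S\<close> is the operator \<open>e^\<alpha>\<close>. The factor \<open>z^(\<alpha>(0))\<close> is the identity,
  because \<open>c(0) = 0\<close> on the space in question.\<close>

definition lattice_mode ::
    "'v::ab_group_add vsa \<Rightarrow> 'v \<Rightarrow> int \<Rightarrow> ('v \<Rightarrow> 'v) \<Rightarrow> int \<Rightarrow> 'v \<Rightarrow> 'v" where
  "lattice_mode P c m S n v = Sum_any (\<lambda>j::nat.
     if int j \<ge> n + 1 then
       exp_coeff (smult P) (\<lambda>i. \<lambda>u. smult P (of_int m / (2 * of_nat i)) (nprod P c (- int i) u))
         (nat (int j - n - 1))
         (exp_coeff (smult P) (\<lambda>i. \<lambda>u. smult P (- of_int m / (2 * of_nat i)) (nprod P c (int i) u))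
           j (S v))
     else 0)"

text \<open>\<open>Pi_monomial P c d E (cs, ds, m)\<close> is \<open>c(-i1)c(-i2)\<cdots> d(-j1)d(-j2)\<cdots> \<otimes> e^(m c/2)\<close>; with
  \<open>Pi_index\<close> as index set, these form the standard basis of \<open>M(1) \<otimes> \<complex>[\<int> c/2]\<close>.\<close>

definition Pi_index :: "(nat list \<times> nat list \<times> int) set" where
  "Pi_index = {(cs, ds, m). sorted cs \<and> sorted ds \<and> 0 \<notin> set cs \<and> 0 \<notin> set ds}"

definition Pi_monomial ::
    "'v vsa \<Rightarrow> 'v \<Rightarrow> 'v \<Rightarrow> (int \<Rightarrow> 'v) \<Rightarrow> nat list \<times> nat list \<times> int \<Rightarrow> 'v" where
  "Pi_monomial P c d E = (\<lambda>(cs, ds, m).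
     foldr (\<lambda>i. nprod P c (- int i)) cs (foldr (\<lambda>j. nprod P d (- int j)) ds (E m)))"

text \<open>\<open>E m\<close> is \<open>e^(m c/2)\<close>. The second block of conditions is the Heisenberg algebra, the third
  is \<open>a(n) e^\<alpha> = \<delta>\<^bsub>n,0\<^esub> \<langle>a,\<alpha>\<rangle> e^\<alpha>\<close> for \<open>n \<ge> 0\<close>, where \<open>\<langle>d, m c/2\<rangle> = m\<close>, and the last one
  says that the fields of the \<open>E m\<close> are the lattice vertex operators.\<close>

definition is_Pi_half ::
    "'v::ab_group_add vsa \<Rightarrow> 'v \<Rightarrow> 'v \<Rightarrow> (int \<Rightarrow> 'v) \<Rightarrow> bool" where
  "is_Pi_half P c d E \<longleftrightarrow>
     vertex_superalgebra P \<and> part P True = {0} \<and> vac P = E 0 \<and>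
     basis_family (smult P) Pi_index (Pi_monomial P c d E) \<and>

     (\<forall>m n v. nprod P c m (nprod P c n v) - nprod P c n (nprod P c m v) = 0) \<and>
     (\<forall>m n v. nprod P d m (nprod P d n v) - nprod P d n (nprod P d m v) = 0) \<and>
     (\<forall>m n v. nprod P c m (nprod P d n v) - nprod P d n (nprod P c m v)
              = smult P (if m + n = 0 then of_int m * 2 else 0) v) \<and>

     (\<forall>m. \<forall>n\<ge>0. nprod P c n (E m) = 0) \<and>
     (\<forall>m. \<forall>n\<ge>0. nprod P d n (E m) = smult P (if n = 0 then of_int m else 0) (E m)) \<and>

     (\<exists>S. \<forall>m. Vector_Spaces.linear (smult P) (smult P) (S m) \<and>
        (\<forall>(cs, ds, n) \<in> Pi_index.
           S m (Pi_monomial P c d E (cs, ds, n)) = Pi_monomial P c d E (cs, ds, m + n)) \<and>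
        (\<forall>n v. nprod P (E m) n v = lattice_mode P c m (S m) n v))"

end

(* Write a = e^(c/2), b = e^(-c/2), rho = i G and beta = d(-1) b + 1/4 c(-1) b.  Then beta and a
   form a Weyl pair, and the target contains the fields rho, Psi, a, b, beta and c with simple
   mutual brackets.  At the critical level
     x = Psi a,   y = rho b + Psi beta - Psi D(b) - 2 D(Psi) b,
   where D is the translation operator; e, h, f are then forced by {x,x} = 2e, {x,y} = h and
   {y,y} = -2f.  The factor i in rho and the coefficient 2 make the higher poles of y with itself
   vanish.  The remaining brackets follow from the super Jacobi identity, except for [f,y] = 0,
   which reduces to y(1) f = 0; here the centrality of T enters.  Finally T is the image of a
   Sugawara vector: 2T = h(-1)h - D(h) + 4 e(-1)f - 2 x(-1)y. *)

theory Submission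
  imports Defs
begin

section \<open>Modes of a vertex superalgebra\<close>

text \<open>Neither V^k nor the factors of the target come with a model: the former is a quotient of
  words in modes, the latter are given by axioms. This shapes both halves of the proof. A map out of
  V^k is determined by mode commutators of five vectors in the target, and that it respects every
  product has to be derived by writing a mode of a word through modes of its letters. On the target
  side, all that is used of the tensor and lattice structure is collected in the locale
  \<open>critical_fields\<close>: the brackets of the generating fields and a few regular products
  of the \<open>E s\<close>. Words in these generators can be brought to a normal form, so each
  product becomes a finite calculation. Modes of the composite fields x, y and h are not expanded in
  it; instead they are moved past the generators, by commutators read off from the products of the
  generators with them. T reaches the image because \<rho>(0)\<rho> = -2T puts the term -2 T b^2
  into y(0)y.\<close>

context vertex_superalgebra
begin

sublocale vs: vector_space "smult V"
  by (rule vector_space)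

abbreviation mode :: "'v \<Rightarrow> int \<Rightarrow> 'v \<Rightarrow> 'v"  ("_\<langle>_\<rangle> _" [71, 0, 70] 70) where
  "a\<langle>n\<rangle> b \<equiv> nprod V a n b"

abbreviation scalar :: "complex \<Rightarrow> 'v \<Rightarrow> 'v"  (infixr "\<cdot>" 75) where
  "s \<cdot> v \<equiv> smult V s v"

abbreviation vacuum :: 'v  ("\<one>") where
  "\<one> \<equiv> vac V"

lemma nprod_hom_left: "module_hom (smult V) (smult V) (\<lambda>a. a\<langle>n\<rangle> b)"
  using nprod_linear_left by (simp add: module_hom_iff_linear)

lemma nprod_hom_right: "module_hom (smult V) (smult V) (\<lambda>b. a\<langle>n\<rangle> b)"
  using nprod_linear_right by (simp add: module_hom_iff_linear)

lemmas nprod_simps [simp] =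
  module_hom.add[OF nprod_hom_left] module_hom.add[OF nprod_hom_right]
  module_hom.scale[OF nprod_hom_left] module_hom.scale[OF nprod_hom_right]
  module_hom.zero[OF nprod_hom_left] module_hom.zero[OF nprod_hom_right]
  module_hom.neg[OF nprod_hom_left] module_hom.neg[OF nprod_hom_right]
  module_hom.diff[OF nprod_hom_left] module_hom.diff[OF nprod_hom_right]

lemma vac_nprod [simp]: "\<one>\<langle>n\<rangle> b = (if n = -1 then b else 0)"
  by (rule vac_left)

lemma nprod_vac [simp]: "n \<ge> 0 \<Longrightarrow> a\<langle>n\<rangle> \<one> = 0" "a\<langle>-1\<rangle> \<one> = a"
  by (simp_all add: vac_right_nonneg vac_right)

lemma scale_numerals:
  "numeral (Num.Bit0 n) \<cdot> v = numeral n \<cdot> v + numeral n \<cdot> v"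
  "numeral (Num.Bit1 n) \<cdot> v = numeral n \<cdot> v + numeral n \<cdot> v + v"
  "numeral Num.One \<cdot> v = v"
  by (simp_all only: numeral.simps vs.scale_left_distrib vs.scale_one)

lemma half_add_half: "(1 / 2) \<cdot> v + (1 / 2) \<cdot> v = v" "(1 / 2) \<cdot> v + ((1 / 2) \<cdot> v + w) = v + w"
  by (simp_all flip: vs.scale_left_distrib add.assoc)

text \<open>The Borcherds identity at n = 0, where only j = 0 survives on its right-hand
  side.\<close>

lemma commutator:
  assumes "a \<in> part V p" "b \<in> part V q"
  shows "a\<langle>m\<rangle> b\<langle>k\<rangle> v = psign p q \<cdot> (b\<langle>k\<rangle> a\<langle>m\<rangle> v)
    + Sum_any (\<lambda>j::nat. (of_int m gchoose j) \<cdot> ((a\<langle>int j\<rangle> b)\<langle>m + k - int j\<rangle> v))"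
proof -
  have "(\<lambda>j::nat. ((-1) ^ j * (of_int 0 gchoose j)) \<cdot>
          (a\<langle>m + 0 - int j\<rangle> b\<langle>k + int j\<rangle> v
           - ((-1) powi 0 * psign p q) \<cdot> (b\<langle>0 + k - int j\<rangle> a\<langle>m + int j\<rangle> v)))
      = (\<lambda>j. if j = 0 then a\<langle>m\<rangle> b\<langle>k\<rangle> v - psign p q \<cdot> (b\<langle>k\<rangle> a\<langle>m\<rangle> v) else 0)"
    by (auto simp: fun_eq_iff gbinomial_0_left)
  from arg_cong[OF this, of Sum_any] show ?thesis
    using borcherds[OF assms, of m 0 k v] unfolding Sum_any.delta
    by (simp only: diff_eq_eq add.commute) simp
qed

text \<open>The brackets computed below have poles of order at most three. Third-order poles stem
  from \<rho>(2)\<rho>, the \<lambda>^2 term in the bracket of G with itself.\<close>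

lemma commutator_trunc:
  assumes "a \<in> part V p" "b \<in> part V q" and trunc: "\<And>j. j \<ge> 3 \<Longrightarrow> a\<langle>j\<rangle> b = 0"
  shows "a\<langle>m\<rangle> b\<langle>k\<rangle> v = psign p q \<cdot> (b\<langle>k\<rangle> a\<langle>m\<rangle> v) + (a\<langle>0\<rangle> b)\<langle>m + k\<rangle> v
    + of_int m \<cdot> ((a\<langle>1\<rangle> b)\<langle>m + k - 1\<rangle> v)
    + (of_int (m * (m - 1)) / 2) \<cdot> ((a\<langle>2\<rangle> b)\<langle>m + k - 2\<rangle> v)"
proof -
  have "Sum_any (\<lambda>j::nat. (of_int m gchoose j) \<cdot> ((a\<langle>int j\<rangle> b)\<langle>m + k - int j\<rangle> v))
    = (\<Sum>j\<in>{0,1,2::nat}. (of_int m gchoose j) \<cdot> ((a\<langle>int j\<rangle> b)\<langle>m + k - int j\<rangle> v))"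
  proof (rule Sum_any.expand_superset)
    show "{j. (of_int m gchoose j) \<cdot> ((a\<langle>int j\<rangle> b)\<langle>m + k - int j\<rangle> v) \<noteq> 0} \<subseteq> {0,1,2::nat}"
    proof
      fix j :: nat
      assume "j \<in> {j. (of_int m gchoose j) \<cdot> ((a\<langle>int j\<rangle> b)\<langle>m + k - int j\<rangle> v) \<noteq> 0}"
      hence "\<not> int j \<ge> 3"
        using trunc by (auto simp: vs.scale_zero_right)
      thus "j \<in> {0,1,2}"
        by auto
    qed
  qed simp
  moreover have "(of_int m gchoose 2 :: complex) = of_int (m * (m - 1)) / 2"
    by (simp add: numeral_2_eq_2 gbinomial_Suc algebra_simps)
  ultimately show ?thesis
    by (simp add: commutator[OF assms(1,2)] algebra_simps)
qed

text \<open>The Borcherds identity at m = 0. It makes induction on words possible, since a mode of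
  a(n)b becomes a sum of products of modes of a and b.\<close>

lemma iterate:
  assumes "a \<in> part V p" "b \<in> part V q"
  shows "(a\<langle>n\<rangle> b)\<langle>k\<rangle> v = Sum_any (\<lambda>j::nat. ((-1) ^ j * (of_int n gchoose j)) \<cdot>
           (a\<langle>n - int j\<rangle> b\<langle>k + int j\<rangle> v
            - ((-1) powi n * psign p q) \<cdot> (b\<langle>n + k - int j\<rangle> a\<langle>int j\<rangle> v)))"
proof -
  have "(\<lambda>j::nat. (of_int 0 gchoose j) \<cdot> ((a\<langle>n + int j\<rangle> b)\<langle>0 + k - int j\<rangle> v))
      = (\<lambda>j. if j = 0 then (a\<langle>n\<rangle> b)\<langle>k\<rangle> v else 0)"
    by (auto simp: fun_eq_iff gbinomial_0_left)
  from arg_cong[OF this, of Sum_any] show ?thesis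
    using borcherds[OF assms, of 0 n k v] unfolding Sum_any.delta
    by simp
qed

lemma homogeneous_cases:
  obtains v0 v1 where "v = v0 + v1" "v0 \<in> part V False" "v1 \<in> part V True"
  using part_sum by metis

lemma minus2_gchoose: "(-1) ^ j * (- 2 gchoose j) = (of_nat j + 1 :: complex)"
proof -
  have "(- 2 gchoose j) = (-1) ^ j * (of_nat j + 1 gchoose j :: complex)"
    using gbinomial_negated_upper[of "-2::complex" j] by (simp add: algebra_simps)
  moreover have "(of_nat j + 1 gchoose j :: complex) = of_nat j + 1"
    using binomial_gbinomial[of "Suc j" j, where 'a = complex] by (simp add: add.commute)
  ultimately show ?thesis
    by (simp flip: power_add mult_2 mult.assoc)
qed

text \<open>In the iterate formula with b the vacuum, only the vacuum mode -1 survives. This selects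
  j = -k - 1 in the first summand and j = k - 1 in the second: one term for k \<noteq> 0, none for k
  = 0.\<close>

lemma translation_homogeneous:
  assumes "a \<in> part V p"
  shows "(a\<langle>-2\<rangle> \<one>)\<langle>k\<rangle> v = (- of_int k) \<cdot> (a\<langle>k - 1\<rangle> v)"
proof -
  have eq: "(a\<langle>-2\<rangle> \<one>)\<langle>k\<rangle> v = Sum_any (\<lambda>j::nat. (of_nat j + 1) \<cdot>
           ((if k + int j = -1 then a\<langle>k - 1\<rangle> v else 0)
            - (if int j = k - 1 then a\<langle>k - 1\<rangle> v else 0)))" (is "_ = Sum_any ?f")
    unfolding iterate[OF assms vac_even]
    by (rule arg_cong[where f = Sum_any])
       (auto simp: fun_eq_iff minus2_gchoose psign_def algebra_simps; smt (verit))
  consider "k = 0" | "k > 0" | "k < 0"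
    by linarith
  then show ?thesis
  proof cases
    case 1
    then have "?f = (\<lambda>j. 0)"
      by (auto simp: fun_eq_iff)
    with 1 eq show ?thesis by simp
  next
    case 2
    then have "?f = (\<lambda>j. if j = nat (k - 1) then (- of_int k) \<cdot> (a\<langle>k - 1\<rangle> v) else 0)"
      by (auto simp: fun_eq_iff)
    with eq show ?thesis by (simp only: Sum_any.delta)
  next
    case 3
    then have "?f = (\<lambda>j. if j = nat (- k - 1) then (- of_int k) \<cdot> (a\<langle>k - 1\<rangle> v) else 0)"
      by (auto simp: fun_eq_iff)
    with eq show ?thesis by (simp only: Sum_any.delta)
  qed
qed

lemma translation: "(a\<langle>-2\<rangle> \<one>)\<langle>k\<rangle> v = (- of_int k) \<cdot> (a\<langle>k - 1\<rangle> v)"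
proof -
  obtain a0 a1 where "a = a0 + a1" "a0 \<in> part V False" "a1 \<in> part V True"
    by (rule homogeneous_cases)
  then show ?thesis
    by (simp add: translation_homogeneous vs.scale_right_distrib del: nprod_simps(3))
qed

end

section \<open>Homomorphisms from universal affine vertex superalgebras\<close>

lemma lookup_pscale [simp]: "Poly_Mapping.lookup (pscale s p) w = s * Poly_Mapping.lookup p w"
  by (simp add: pscale_def Poly_Mapping.map.rep_eq when_def)

lemma pscale_vector_space: "vector_space pscale"
  by unfold_locales (auto intro!: poly_mapping_eqI simp: lookup_add algebra_simps)

context vertex_superalgebra
begin

definition word_vector :: "('g \<Rightarrow> 'v) \<Rightarrow> ('g \<times> int) list \<Rightarrow> 'v" where
  "word_vector J w = foldr (\<lambda>(a, n). nprod V (J a) n) w \<one>"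

definition word_parity :: "('g \<Rightarrow> bool) \<Rightarrow> ('g \<times> int) list \<Rightarrow> bool" where
  "word_parity par w = foldr (\<lambda>(a, n) q. par a \<noteq> q) w False"

lemma word_vector_simps [simp]:
  "word_vector J [] = \<one>"
  "word_vector J ((a, n) # w) = (J a)\<langle>n\<rangle> word_vector J w"
  by (simp_all add: word_vector_def)

lemma word_vector_parity:
  assumes "\<And>a. J a \<in> part V (par a)"
  shows "word_vector J w \<in> part V (word_parity par w)"
proof (induction w)
  case (Cons p w)
  then show ?case
    by (cases p) (use nprod_parity[OF assms Cons] in \<open>simp add: word_parity_def\<close>)
qed (simp add: vac_even word_parity_def)

text \<open>The supports of p, q and p + q differ; a common finite index set makes their sums
  comparable.\<close>

lemma word_action_superset:
  assumes "finite S" "Poly_Mapping.keys p \<subseteq> S"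
  shows "word_action V J p = (\<Sum>w\<in>S. Poly_Mapping.lookup p w \<cdot> word_vector J w)"
  unfolding word_action_def word_vector_def
  by (rule sum.mono_neutral_left) (use assms in \<open>auto simp: in_keys_iff vs.scale_zero_left\<close>)

lemma word_action_word [simp]: "word_action V J (word w) = word_vector J w"
  by (subst word_action_superset[of "{w}"]) (auto simp: in_keys_iff lookup_single when_def split: if_splits)

lemma word_action_hom:
  fixes J :: "'g \<Rightarrow> 'v"
  shows "module_hom pscale (smult V) (word_action V J)"
proof -
  interpret ps: vector_space pscale
    by (rule pscale_vector_space)
  show ?thesis
  proof
    fix p q :: "('g \<times> int) list \<Rightarrow>\<^sub>0 complex"
    let ?S = "Poly_Mapping.keys p \<union> Poly_Mapping.keys q"
    have "Poly_Mapping.keys (p + q) \<subseteq> ?S"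
      by (rule Poly_Mapping.keys_add)
    then show "word_action V J (p + q) = word_action V J p + word_action V J q"
      by (subst (1 2 3) word_action_superset[of ?S])
         (simp_all add: lookup_add vs.scale_left_distrib sum.distrib)
  next
    fix s and p :: "('g \<times> int) list \<Rightarrow>\<^sub>0 complex"
    have "Poly_Mapping.keys (pscale s p) \<subseteq> Poly_Mapping.keys p"
      by (auto simp: in_keys_iff)
    then show "word_action V J (pscale s p) = s \<cdot> word_action V J p"
      by (subst (1 2) word_action_superset[of "Poly_Mapping.keys p"])
         (simp_all add: vs.scale_sum_right)
  qed
qed

lemma foldr_mode_hom:
  "module_hom (smult V) (smult V) (foldr (\<lambda>(a, n). nprod V (J a) n) u)"
proof (induction u)
  case Nil
  show ?case using vs.module_hom_id by (simp add: id_def module_hom_iff_linear)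
next
  case (Cons p u)
  obtain a n where "p = (a, n)" by (cases p)
  then show ?case
    using module_hom_compose[OF Cons nprod_hom_right[of "J a" n]] by (simp add: o_def)
qed

text \<open>Truncation kills both summands for large j. This allows a linear map to be pulled
  through \<open>Sum_any\<close>, which is 0 by default on infinite support.\<close>

lemma iterate_finite_support:
  "finite {j::nat. s j \<cdot> (a\<langle>n - int j\<rangle> b\<langle>k + int j\<rangle> v - r \<cdot> (b\<langle>n + k - int j\<rangle> a\<langle>int j\<rangle> v)) \<noteq> 0}"
proof -
  obtain M1 M2 where M: "\<And>n. n \<ge> M1 \<Longrightarrow> b\<langle>n\<rangle> v = 0" "\<And>n. n \<ge> M2 \<Longrightarrow> a\<langle>n\<rangle> v = 0"
    using truncation by metis
  show ?thesis
    by (rule finite_subset[of _ "{..nat (max (M1 - k) M2)}"])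
       (auto, metis (no_types) M add.commute diff_le_eq le_max_iff_disj linorder_le_cases max.bounded_iff
         module_hom.zero[OF nprod_hom_right] nat_le_iff vs.scale_zero_right diff_self)
qed

end

text \<open>The kernel of the word action in \<open>V\<close> is spanned by the affine relations,
  and these also act by zero in \<open>W\<close>; hence words may be sent to words. Compatibility
  with all products is an induction on the word in the left argument.\<close>

lemma affine_hom_exists:
  assumes V: "universal_affine par br form k V J"
    and W: "vertex_superalgebra W"
    and parity: "\<And>a. I a \<in> part W (par a)"
    and relations: "\<And>a b m n v. nprod W (I a) m (nprod W (I b) n v)
        = smult W (psign (par a) (par b)) (nprod W (I b) n (nprod W (I a) m v))
          + (\<Sum>c\<in>UNIV. smult W (br a b c) (nprod W (I c) (m + n) v))
          + smult W (if m + n = 0 then of_int m * form a b * k else 0) v"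
  shows "\<exists>\<Phi>. vsa_hom V W \<Phi> \<and> (\<forall>a. \<Phi> (J a) = I a)"
proof -
  interpret V: vertex_superalgebra V
    using V by (simp add: universal_affine_def)
  interpret W: vertex_superalgebra W
    by (rule W)
  interpret ps: vector_space pscale
    by (rule pscale_vector_space)
  interpret aV: module_hom pscale "smult V" "word_action V J"
    by (rule V.word_action_hom)
  interpret aW: module_hom pscale "smult W" "word_action W I"
    by (rule W.word_action_hom)
  have J: "J a \<in> part V (par a)" for a
    using V by (simp add: universal_affine_def)
  have surj: "\<exists>p. v = word_action V J p" for v
    using V unfolding universal_affine_def by blast
  have "word_action W I p = 0" if "p \<in> ps.span (affine_relations par br form k)" for p
    using that
  proof (induction rule: ps.span_induct)
    show "ps.subspace {p. word_action W I p = 0}"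
      by (rule aW.subspace_kernel)
    fix p assume "p \<in> affine_relations par br form k"
    then consider (bracket) u a m b n w where
        "p = word (u @ [(a, m), (b, n)] @ w)
          - pscale (psign (par a) (par b)) (word (u @ [(b, n), (a, m)] @ w))
          - (\<Sum>c\<in>UNIV. pscale (br a b c) (word (u @ [(c, m + n)] @ w)))
          - pscale (if m + n = 0 then of_int m * form a b * k else 0) (word (u @ w))"
      | (vac) u a n where "p = word (u @ [(a, n)])" "n \<ge> 0"
      unfolding affine_relations_def by blast
    then show "word_action W I p = 0"
    proof cases
      case bracket
      interpret u: module_hom "smult W" "smult W" "foldr (\<lambda>(a, n). nprod W (I a) n) u"
        by (rule W.foldr_mode_hom)
      have wv: "W.word_vector I (u @ w') = foldr (\<lambda>(a, n). nprod W (I a) n) u (W.word_vector I w')" for w'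
        by (simp add: W.word_vector_def)
      have "word_action W I p = foldr (\<lambda>(a, n). nprod W (I a) n) u
        (nprod W (I a) m (nprod W (I b) n (W.word_vector I w))
          - (smult W (psign (par a) (par b)) (nprod W (I b) n (nprod W (I a) m (W.word_vector I w)))
          + (\<Sum>c\<in>UNIV. smult W (br a b c) (nprod W (I c) (m + n) (W.word_vector I w)))
          + smult W (if m + n = 0 then of_int m * form a b * k else 0) (W.word_vector I w)))"
        unfolding bracket aW.diff aW.sum aW.scale W.word_action_word wv u.diff u.add u.sum u.scale
        by simp
      then show ?thesis
        unfolding relations[of a m b n] by (simp add: u.zero)
    next
      case vac
      interpret u: module_hom "smult W" "smult W" "foldr (\<lambda>(a, n). nprod W (I a) n) u"
        by (rule W.foldr_mode_hom)
      show ?thesis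
        using vac u.zero by (simp add: W.word_vector_def)
    qed
  qed
  moreover have "{p. word_action V J p = 0} = ps.span (affine_relations par br form k)"
    using V by (simp add: universal_affine_def)
  ultimately have kernel: "word_action W I p = 0" if "word_action V J p = 0" for p
    using that by blast

  \<comment> \<open>Any preimage serves: two of them differ by an element of the kernel, which acts
    by zero in \<open>W\<close>.\<close>
  define \<Phi> where "\<Phi> v = word_action W I (SOME p. word_action V J p = v)" for v
  have act [simp]: "\<Phi> (word_action V J p) = word_action W I p" for p
  proof -
    have "word_action V J (SOME q. word_action V J q = word_action V J p) = word_action V J p"
      by (rule someI) simp
    then have "word_action V J ((SOME q. word_action V J q = word_action V J p) - p) = 0"
      by (simp add: aV.diff)
    from kernel[OF this] show ?thesis
      by (simp add: \<Phi>_def aW.diff)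
  qed
  interpret \<Phi>: module_hom "smult V" "smult W" \<Phi>
  proof
    show "\<Phi> (u + v) = \<Phi> u + \<Phi> v" for u v
      using surj[of u] surj[of v] act aV.add aW.add by metis
    show "\<Phi> (smult V s v) = smult W s (\<Phi> v)" for s v
      using surj[of v] act aV.scale aW.scale by metis
  qed
  have \<Phi>_word: "\<Phi> (V.word_vector J w) = W.word_vector I w" for w
    using act[of "word w"] by simp
  have expand: "\<exists>S s. finite S \<and> v = (\<Sum>w\<in>S. smult V (s w) (V.word_vector J w))" for v
    using surj[of v] V.word_action_superset[of _ _ J] by (metis finite_keys order_refl)
  have agree: "f v = g v"
    if "module_hom (smult V) (smult W) f" "module_hom (smult V) (smult W) g"
      "\<And>w. f (V.word_vector J w) = g (V.word_vector J w)" for f g v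
  proof -
    obtain S s where v: "v = (\<Sum>w\<in>S. smult V (s w) (V.word_vector J w))"
      using expand by metis
    show ?thesis
      unfolding v module_hom.sum[OF that(1)] module_hom.sum[OF that(2)]
        module_hom.scale[OF that(1)] module_hom.scale[OF that(2)] that(3) ..
  qed
  have \<Phi>_J: "\<Phi> (nprod V (J a) n v) = nprod W (I a) n (\<Phi> v)" for a n v
  proof (rule agree)
    show "module_hom (smult V) (smult W) (\<lambda>v. \<Phi> (nprod V (J a) n v))"
      using module_hom_compose[OF V.nprod_hom_right \<Phi>.module_hom_axioms] by (simp add: o_def)
    show "module_hom (smult V) (smult W) (\<lambda>v. nprod W (I a) n (\<Phi> v))"
      using module_hom_compose[OF \<Phi>.module_hom_axioms W.nprod_hom_right] by (simp add: o_def)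
    show "\<Phi> (nprod V (J a) n (V.word_vector J w)) = nprod W (I a) n (\<Phi> (V.word_vector J w))" for w
      using \<Phi>_word[of "(a, n) # w"] \<Phi>_word[of w] by simp
  qed
  \<comment> \<open>\<open>iterate\<close> expands a mode of the word into modes of its first
    letter, covered by \<open>\<Phi>_J\<close>, and modes of the shorter word. Both \<open>n\<close>
    and \<open>v\<close> change in the expansion, so the induction must generalise them.\<close>
  have \<Phi>_word_nprod: "\<Phi> (nprod V (V.word_vector J w) n v) = nprod W (W.word_vector I w) n (\<Phi> v)" for w n v
  proof (induction w arbitrary: n v)
    case Nil
    show ?case by (simp add: \<Phi>.zero)
  next
    case (Cons p w)
    obtain a i where p: "p = (a, i)" by (cases p)
    let ?pw = "word_parity par w"
    let ?f = "\<lambda>j::nat. smult V ((-1) ^ j * (of_int i gchoose j))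
        (nprod V (J a) (i - int j) (nprod V (V.word_vector J w) (n + int j) v)
         - smult V ((-1) powi i * psign (par a) (V.word_parity par w))
             (nprod V (V.word_vector J w) (i + n - int j) (nprod V (J a) (int j) v)))"
    have "\<Phi> (Sum_any ?f) = Sum_any (\<lambda>j. \<Phi> (?f j))"
    proof -
      have "Sum_any (\<lambda>j. \<Phi> (?f j)) = (\<Sum>j | ?f j \<noteq> 0. \<Phi> (?f j))"
        by (rule Sum_any.expand_superset[OF V.iterate_finite_support]) (auto simp: \<Phi>.zero)
      then show ?thesis
        by (simp only: Sum_any.expand_set \<Phi>.sum)
    qed
    also have "\<dots> = nprod W (nprod W (I a) i (W.word_vector I w)) n (\<Phi> v)"
      unfolding W.iterate[OF parity W.word_vector_parity[of I, OF parity]]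
        \<Phi>.scale \<Phi>.diff \<Phi>_J Cons
      by (simp add: V.word_parity_def W.word_parity_def)
    finally show ?case
      unfolding p V.word_vector_simps W.word_vector_simps
        V.iterate[OF J V.word_vector_parity[of J, OF J]] .
  qed
  have \<Phi>_nprod: "\<Phi> (nprod V u n v) = nprod W (\<Phi> u) n (\<Phi> v)" for u n v
  proof (rule agree[of "\<lambda>u. \<Phi> (nprod V u n v)" "\<lambda>u. nprod W (\<Phi> u) n (\<Phi> v)"])
    show "module_hom (smult V) (smult W) (\<lambda>u. \<Phi> (nprod V u n v))"
      using module_hom_compose[OF V.nprod_hom_left \<Phi>.module_hom_axioms] by (simp add: o_def)
    show "module_hom (smult V) (smult W) (\<lambda>u. nprod W (\<Phi> u) n (\<Phi> v))"
      using module_hom_compose[OF \<Phi>.module_hom_axioms W.nprod_hom_left] by (simp add: o_def)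
  qed (simp add: \<Phi>_word_nprod \<Phi>_word)
  \<comment> \<open>The expansion of \<open>v\<close> may contain words of both parities. Those of
    the wrong parity sum to a vector lying in both parts, which is therefore 0.\<close>
  have \<Phi>_part: "\<Phi> v \<in> part W p" if v: "v \<in> part V p" for v p
  proof -
    obtain S s where S: "finite S" "v = (\<Sum>w\<in>S. smult V (s w) (V.word_vector J w))"
      using expand by metis
    define vq where "vq q = (\<Sum>w\<in>{w\<in>S. V.word_parity par w = q}. smult V (s w) (V.word_vector J w))" for q
    have vq: "vq q \<in> part V q" for q
      unfolding vq_def
      by (rule V.vs.subspace_sum[OF V.part_subspace], rule V.vs.subspace_scale[OF V.part_subspace])
         (use V.word_vector_parity[of J par, OF J] in auto)
    have "v = vq p + vq (\<not> p)"
      unfolding S(2) vq_def by (subst sum.union_disjoint[symmetric]) (auto simp: S(1) intro!: sum.cong)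
    then have "vq (\<not> p) = v - vq p"
      by simp
    then have "vq (\<not> p) \<in> part V p \<inter> part V (\<not> p)"
      using V.vs.subspace_diff[OF V.part_subspace v vq[of p]] vq[of "\<not> p"] by simp
    then have "vq (\<not> p) = 0"
      using V.part_disjoint by (cases p) auto
    with \<open>v = vq p + vq (\<not> p)\<close> have "\<Phi> v = \<Phi> (vq p)"
      by simp
    also have "\<dots> \<in> part W p"
      unfolding vq_def \<Phi>.sum \<Phi>.scale \<Phi>_word
      by (rule W.vs.subspace_sum[OF W.part_subspace], rule W.vs.subspace_scale[OF W.part_subspace])
         (use W.word_vector_parity[of I par, OF parity] in \<open>auto simp: V.word_parity_def W.word_parity_def\<close>)
    finally show ?thesis .
  qed
  have "vsa_hom V W \<Phi>"
    unfolding vsa_hom_def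
    using V.vertex_superalgebra_axioms W \<Phi>.module_hom_axioms \<Phi>_part \<Phi>_nprod \<Phi>_word[of "[]"]
    by (auto simp: module_hom_iff_linear)
  moreover have "\<Phi> (J a) = I a" for a
    using \<Phi>_word[of "[(a, -1)]"] by simp
  ultimately show ?thesis
    by blast
qed

section \<open>Tensor products of vertex superalgebras\<close>

locale vsa_tensor =
  V1: vertex_superalgebra V1 + V2: vertex_superalgebra V2
  for V1 :: "'a::ab_group_add vsa" and V2 :: "'b::ab_group_add vsa" +
  fixes W :: "'w::ab_group_add vsa" and t :: "'a \<Rightarrow> 'b \<Rightarrow> 'w"
  assumes tensor: "tensor_product V1 V2 W t"
begin

sublocale W: vertex_superalgebra W
  using tensor by (simp add: tensor_product_def)

lemma hom_left: "module_hom (smult V1) (smult W) (\<lambda>a. t a b)"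
  and hom_right: "module_hom (smult V2) (smult W) (\<lambda>b. t a b)"
  using tensor by (auto simp: tensor_product_def tensor_space_def module_hom_iff_linear)

lemmas t_simps [simp] =
  module_hom.add[OF hom_left] module_hom.add[OF hom_right]
  module_hom.scale[OF hom_left] module_hom.scale[OF hom_right]
  module_hom.zero[OF hom_left] module_hom.zero[OF hom_right]

lemma t_vac: "t (vac V1) (vac V2) = vac W"
  using tensor by (simp add: tensor_product_def)

lemma t_part: "a \<in> part V1 p \<Longrightarrow> b \<in> part V2 q \<Longrightarrow> t a b \<in> part W (p \<noteq> q)"
  using tensor by (auto simp: tensor_product_def)

lemma t_nprod:
  assumes "b \<in> part V2 p" "u \<in> part V1 q"
  shows "nprod W (t a b) n (t u v) =
    smult W (psign p q) (Sum_any (\<lambda>j::int. t (nprod V1 a j u) (nprod V2 b (n - 1 - j) v)))"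
  using tensor assms by (auto simp: tensor_product_def)

definition inl :: "'a \<Rightarrow> 'w" where "inl a = t a (vac V2)"

definition inr :: "'b \<Rightarrow> 'w" where "inr b = t (vac V1) b"

text \<open>The vacuum of \<open>V2\<close> acts only by its mode -1, which leaves j = n; it is
  even, so no sign arises.\<close>

lemma inl_nprod_t: "nprod W (inl a) n (t u v) = t (nprod V1 a n u) v"
proof -
  have "nprod W (inl a) n (t u v) = t (nprod V1 a n u) v" if "u \<in> part V1 q" for u q
  proof -
    have "(\<lambda>j. t (nprod V1 a j u) (nprod V2 (vac V2) (n - 1 - j) v))
        = (\<lambda>j. if j = n then t (nprod V1 a n u) v else 0)"
      by (auto simp: fun_eq_iff)
    from arg_cong[OF this, of Sum_any] show ?thesis
      unfolding inl_def t_nprod[OF V2.vac_even that] Sum_any.delta by (simp only: psign_def) simp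
  qed
  then show ?thesis
    using V1.part_sum[of u] by auto
qed

lemma inr_nprod_t:
  assumes "b \<in> part V2 p" "u \<in> part V1 q"
  shows "nprod W (inr b) n (t u v) = smult W (psign p q) (t u (nprod V2 b n v))"
proof -
  have "(\<lambda>j. t (nprod V1 (vac V1) j u) (nprod V2 b (n - 1 - j) v))
      = (\<lambda>j. if j = -1 then t u (nprod V2 b n v) else 0)"
    by (auto simp: fun_eq_iff)
  from arg_cong[OF this, of Sum_any] show ?thesis
    unfolding inr_def t_nprod[OF assms] Sum_any.delta by (simp only:)
qed

lemma inr_nprod_inr: "nprod W (inr a) n (inr b) = inr (nprod V2 a n b)"
proof -
  have "nprod W (inr a) n (inr b) = inr (nprod V2 a n b)" if "a \<in> part V2 p" for a p
    using inr_nprod_t[OF that V1.vac_even] by (simp add: psign_def inr_def)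
  moreover obtain a0 a1 where "a = a0 + a1" "a0 \<in> part V2 False" "a1 \<in> part V2 True"
    by (rule V2.homogeneous_cases)
  ultimately show ?thesis
    by (simp add: inr_def)
qed

lemma inl_hom: "vsa_hom V1 W inl"
  unfolding vsa_hom_def
  using V1.vertex_superalgebra_axioms W.vertex_superalgebra_axioms hom_left[of "vac V2"]
    t_part[OF _ V2.vac_even] inl_nprod_t[of _ _ _ "vac V2"] t_vac
  by (auto simp: inl_def[abs_def] module_hom_iff_linear)

lemma inr_hom: "vsa_hom V2 W inr"
proof -
  have "inr ` part V2 p \<subseteq> part W p" for p
    using t_part[OF V1.vac_even] by (auto simp: inr_def)
  then show ?thesis
    unfolding vsa_hom_def
    using V2.vertex_superalgebra_axioms W.vertex_superalgebra_axioms hom_right[of "vac V1"]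
      inr_nprod_inr t_vac
    by (auto simp: inr_def[abs_def] module_hom_iff_linear)
qed

text \<open>A nonnegative mode of a meets the vacuum of \<open>V1\<close>. Consequently the fields
  of the two factors supercommute.\<close>

lemma inl_nprod_inr: "n \<ge> 0 \<Longrightarrow> nprod W (inl a) n (inr b) = 0"
  by (simp add: inr_def inl_nprod_t)

text \<open>\<open>tensor_space\<close> speaks about bases only, so a vector has to be placed into a
  basis before its tensors can be shown to be nonzero.\<close>

lemma basis_superset:
  assumes "vector_space s" "(v :: 'v::ab_group_add) \<noteq> 0"
  shows "\<exists>A. v \<in> A \<and> basis_family s A id"
proof -
  interpret vector_space s by fact
  have "independent {v}"
    using assms(2) by (simp add: dependent_single)
  then have "v \<in> extend_basis {v} \<and> basis_family s (extend_basis {v}) id"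
    using extend_basis_superset[of "{v}"] independent_extend_basis span_extend_basis
    by (auto simp: basis_family_def)
  then show ?thesis ..
qed

lemma tensor_basis:
  "basis_family (smult V1) A id \<Longrightarrow> basis_family (smult V2) B id \<Longrightarrow>
    basis_family (smult W) (A \<times> B) (\<lambda>(a, b). t a b)"
  using tensor by (auto simp: tensor_product_def tensor_space_def)

lemma t_nonzero:
  assumes "a \<noteq> 0" "b \<noteq> 0"
  shows "t a b \<noteq> 0"
proof -
  obtain A B where "a \<in> A" "b \<in> B" "basis_family (smult W) (A \<times> B) (\<lambda>(a, b). t a b)"
    using basis_superset[OF V1.vector_space assms(1)] basis_superset[OF V2.vector_space assms(2)]
      tensor_basis by meson
  then have "t a b \<in> (\<lambda>(a, b). t a b) ` (A \<times> B)" "\<not> W.vs.dependent ((\<lambda>(a, b). t a b) ` (A \<times> B))"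
    by (auto simp: basis_family_def)
  then show ?thesis
    using W.vs.dependent_zero by metis
qed

lemma span_t: "w \<in> W.vs.span {t a b | a b. True}"
proof -
  have "\<exists>A. basis_family s A id" if "vector_space s" for s :: "complex \<Rightarrow> 'v \<Rightarrow> 'v::ab_group_add"
  proof -
    interpret vector_space s by fact
    have "basis_family s (extend_basis {}) id"
      using independent_extend_basis[OF independent_empty] span_extend_basis[OF independent_empty]
      by (auto simp: basis_family_def)
    then show ?thesis ..
  qed
  then obtain A B where "basis_family (smult W) (A \<times> B) (\<lambda>(a, b). t a b)"
    using V1.vector_space V2.vector_space tensor_basis by meson
  then have "w \<in> W.vs.span ((\<lambda>(a, b). t a b) ` (A \<times> B))"
    by (simp add: basis_family_def)
  then show ?thesis
    by (rule W.vs.span_mono[THEN subsetD, rotated]) auto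
qed

lemma inl_annihilates:
  assumes "\<And>u. nprod V1 a n u = 0"
  shows "nprod W (inl a) n w = 0"
proof -
  interpret module_hom "smult W" "smult W" "nprod W (inl a) n"
    by (rule W.nprod_hom_right)
  show ?thesis
    using span_t
    by (induction w rule: W.vs.span_induct) (auto simp: subspace_kernel inl_nprod_t assms)
qed

end

section \<open>The half lattice vertex algebra\<close>

locale lattice_vsa = vertex_superalgebra +
  fixes c d :: 'a and E :: "int \<Rightarrow> 'a"
  assumes Pi_half: "is_Pi_half V c d E"
begin

lemma E_0 [simp]: "E 0 = \<one>"
  using Pi_half by (simp add: is_Pi_half_def)

lemma even [simp]: "a \<in> part V False"
proof -
  have "part V True = {0}"
    using Pi_half by (simp add: is_Pi_half_def)
  then show ?thesis
    using part_sum[of a] by auto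
qed

lemma heisenberg:
  "c\<langle>m\<rangle> d\<langle>n\<rangle> v = d\<langle>n\<rangle> c\<langle>m\<rangle> v + (if m + n = 0 then of_int m * 2 else 0) \<cdot> v"
  using Pi_half by (simp add: is_Pi_half_def algebra_simps)

lemma heisenberg': "d\<langle>m\<rangle> c\<langle>n\<rangle> v = c\<langle>n\<rangle> d\<langle>m\<rangle> v + (if m + n = 0 then of_int m * 2 else 0) \<cdot> v"
  using heisenberg[of n m v] by (auto simp: add_eq_0_iff vs.scale_minus_left)

lemma c_c_commute: "c\<langle>m\<rangle> c\<langle>n\<rangle> v = c\<langle>n\<rangle> c\<langle>m\<rangle> v"
  and d_d_commute: "d\<langle>m\<rangle> d\<langle>n\<rangle> v = d\<langle>n\<rangle> d\<langle>m\<rangle> v"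
  using Pi_half by (simp_all add: is_Pi_half_def)

lemma c_E [simp]: "n \<ge> 0 \<Longrightarrow> c\<langle>n\<rangle> E s = 0"
  and d_E [simp]: "n \<ge> 0 \<Longrightarrow> d\<langle>n\<rangle> E s = (if n = 0 then of_int s else 0) \<cdot> E s"
  using Pi_half by (auto simp: is_Pi_half_def)

lemma vac_nonzero: "\<one> \<noteq> 0"
proof -
  have "([], [], 0) \<in> Pi_index"
    by (simp add: Pi_index_def)
  then have "Pi_monomial V c d E ([], [], 0) \<in> Pi_monomial V c d E ` Pi_index"
    by (rule imageI)
  then have "\<one> \<in> Pi_monomial V c d E ` Pi_index"
    by (simp only: Pi_monomial_def prod.case foldr.simps id_apply E_0)
  moreover have "\<not> vs.dependent (Pi_monomial V c d E ` Pi_index)"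
    using Pi_half by (simp add: is_Pi_half_def basis_family_def)
  ultimately show ?thesis
    by (metis vs.dependent_zero)
qed

text \<open>In a nonempty list the last operator acts on v itself and gives 0; the empty list occurs
  only for r = 0.\<close>

lemma exp_coeff_annihilated:
  assumes "\<And>i. X i 0 = 0" "\<And>i. i > 0 \<Longrightarrow> X i v = 0"
  shows "exp_coeff (smult V) X r v = (if r = 0 then v else 0)"
proof -
  have "foldr X ns v = 0" if "ns \<noteq> []" "0 \<notin> set ns" for ns
    using that
  proof (induction ns)
    case (Cons i ns)
    then show ?case
      by (cases "ns = []") (simp_all add: assms)
  qed simp
  then have terms: "smult V (1 / fact (length ns)) (foldr X ns v) = 0" if "ns \<noteq> []" "0 \<notin> set ns" for ns
    using that by simp
  have "ns = []" if "sum_list ns = 0" "0 \<notin> set ns" for ns :: "nat list"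
    using that by (cases ns) auto
  then have "{ns. sum_list ns = 0 \<and> 0 \<notin> set ns} = {[]::nat list}"
    by auto
  moreover have "exp_coeff (smult V) X r v = 0" if "r \<noteq> 0"
    unfolding exp_coeff_def
  proof (intro sum.neutral ballI)
    fix ns :: "nat list"
    assume "ns \<in> {ns. sum_list ns = r \<and> 0 \<notin> set ns}"
    with that have "ns \<noteq> []" "0 \<notin> set ns"
      by auto
    then show "(1 / fact (length ns)) \<cdot> foldr X ns v = 0"
      by (rule terms)
  qed
  ultimately show ?thesis
    by (auto simp: exp_coeff_def)
qed

text \<open>The positive modes of c kill \<open>E (s + u)\<close>, so the annihilating exponential
  is trivial. The creating one has only nonnegative powers of z, whence no poles.\<close>

lemma E_nprod_E: "(E s)\<langle>n\<rangle> E u = (if n < 0 then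
    exp_coeff (smult V) (\<lambda>i v. (of_int s / (2 * of_nat i)) \<cdot> (c\<langle>- int i\<rangle> v)) (nat (- n - 1)) (E (s + u))
  else 0)"
proof -
  have "\<exists>S. \<forall>m. Vector_Spaces.linear (smult V) (smult V) (S m) \<and>
      (\<forall>(cs, ds, n) \<in> Pi_index.
         S m (Pi_monomial V c d E (cs, ds, n)) = Pi_monomial V c d E (cs, ds, m + n)) \<and>
      (\<forall>n v. nprod V (E m) n v = lattice_mode V c m (S m) n v)"
    using Pi_half unfolding is_Pi_half_def by (elim conjE)
  then obtain S where S: "\<forall>(cs, ds, n) \<in> Pi_index.
        S s (Pi_monomial V c d E (cs, ds, n)) = Pi_monomial V c d E (cs, ds, s + n)"
      "\<And>n v. nprod V (E s) n v = lattice_mode V c s (S s) n v"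
    by blast
  have "([], [], u) \<in> Pi_index"
    by (simp add: Pi_index_def)
  from bspec[OF S(1) this] have SE: "S s (E u) = E (s + u)"
    by (simp add: Pi_monomial_def)
  have ann: "exp_coeff (smult V) (\<lambda>i v. (- of_int s / (2 * of_nat i)) \<cdot> (c\<langle>int i\<rangle> v)) j (E (s + u))
      = (if j = 0 then E (s + u) else 0)" for j
    by (rule exp_coeff_annihilated) auto
  let ?X = "\<lambda>i v. (of_int s / (2 * of_nat i)) \<cdot> (c\<langle>- int i\<rangle> v)"
  have zero: "exp_coeff (smult V) ?X r 0 = 0" for r
    by (subst exp_coeff_annihilated) auto
  have "(\<lambda>j::nat. if int j \<ge> n + 1 then exp_coeff (smult V) ?X (nat (int j - n - 1))
      (if j = 0 then E (s + u) else 0) else 0)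
    = (\<lambda>j. if j = 0 then if n < 0 then exp_coeff (smult V) ?X (nat (- n - 1)) (E (s + u)) else 0 else 0)"
    by (auto simp: fun_eq_iff zero)
  from arg_cong[OF this, of Sum_any] show ?thesis
    unfolding S(2) lattice_mode_def SE ann Sum_any.delta .
qed

lemma E_nprod_E_nonneg [simp]: "n \<ge> 0 \<Longrightarrow> (E s)\<langle>n\<rangle> E u = 0"
  by (simp add: E_nprod_E)

lemma E_nprod_E_minus1 [simp]: "(E s)\<langle>-1\<rangle> E u = E (s + u)"
proof -
  have "ns = []" if "sum_list ns = 0" "0 \<notin> set ns" for ns :: "nat list"
    using that by (cases ns) auto
  then have "{ns. sum_list ns = 0 \<and> 0 \<notin> set ns} = {[]::nat list}"
    by auto
  then show ?thesis
    by (simp add: E_nprod_E exp_coeff_def)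
qed

lemma E_nprod_E_minus2: "(E s)\<langle>-2\<rangle> E u = (of_int s / 2) \<cdot> (c\<langle>-1\<rangle> E (s + u))"
proof -
  have "ns = [1]" if "sum_list ns = 1" "0 \<notin> set ns" for ns :: "nat list"
    using that by (cases ns; cases "tl ns") auto
  then have "{ns. sum_list ns = 1 \<and> 0 \<notin> set ns} = {[1]::nat list}"
    by auto
  then show ?thesis
    by (simp add: E_nprod_E exp_coeff_def)
qed

text \<open>This is the coefficient of z^2. The compositions of 2 are 2 and 1 + 1, with weights s/4
  and (s/2)^2 / 2!.\<close>

lemma E_nprod_E_minus3: "(E s)\<langle>-3\<rangle> E u =
  (of_int s / 4) \<cdot> (c\<langle>-2\<rangle> E (s + u)) + (of_int s ^ 2 / 8) \<cdot> (c\<langle>-1\<rangle> c\<langle>-1\<rangle> E (s + u))"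
proof -
  have "ns = [2] \<or> ns = [1, 1]" if ns: "sum_list ns = 2" "0 \<notin> set ns" for ns :: "nat list"
  proof (cases ns)
    case (Cons n ms)
    then show ?thesis
      using ns by (cases ms; cases "tl ms") auto
  qed (use ns in simp)
  then have "{ns. sum_list ns = 2 \<and> 0 \<notin> set ns} = {[2], [1, 1]::nat list}"
    by auto
  then show ?thesis
    by (simp add: E_nprod_E exp_coeff_def power2_eq_square)
qed

section \<open>The Weyl pair inside the half lattice algebra\<close>

abbreviation \<kappa> :: 'a where "\<kappa> \<equiv> (1 / 2) \<cdot> c"

lemma c_c_nonneg: "n \<ge> 0 \<Longrightarrow> c\<langle>n\<rangle> c = 0"
  using c_c_commute[of n "-1" \<one>] by simp

text \<open>The pair \<open>\<beta>\<close>, \<open>E 1\<close> is a Weyl pair: \<open>\<beta>\<close> acts as the derivative with respect to \<open>E 1\<close>.\<close>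

definition \<beta> :: 'a where "\<beta> = d\<langle>-1\<rangle> E (-1) + (1 / 4) \<cdot> (c\<langle>-1\<rangle> E (-1))"

lemma c_E_commute: "c\<langle>m\<rangle> (E s)\<langle>n\<rangle> v = (E s)\<langle>n\<rangle> c\<langle>m\<rangle> v"
  by (subst commutator_trunc[of c False "E s" False]) (simp_all add: psign_def)

lemma d_E_commute: "d\<langle>m\<rangle> (E s)\<langle>n\<rangle> v = (E s)\<langle>n\<rangle> d\<langle>m\<rangle> v + of_int s \<cdot> ((E s)\<langle>m + n\<rangle> v)"
  by (subst commutator_trunc[of d False "E s" False]) (simp_all add: psign_def)

lemma E_\<beta>: "n \<ge> 0 \<Longrightarrow> (E s)\<langle>n\<rangle> \<beta> = (if n = 0 then - of_int s else 0) \<cdot> E (s - 1)"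
  using d_E_commute[of "-1" s n "E (-1)"]
  by (auto simp: \<beta>_def eq_neg_iff_add_eq_0 add.commute simp flip: c_E_commute)

lemma E_\<beta>_commute: "(E s)\<langle>m\<rangle> \<beta>\<langle>n\<rangle> v = \<beta>\<langle>n\<rangle> (E s)\<langle>m\<rangle> v - of_int s \<cdot> ((E (s - 1))\<langle>m + n\<rangle> v)"
  by (subst commutator_trunc[of "E s" False \<beta> False]) (simp_all add: psign_def E_\<beta>)

text \<open>The commutator applied to the vacuum reverses the order of a product and so replaces
  skew-symmetry.\<close>

lemma \<beta>_E: "n \<ge> 0 \<Longrightarrow> \<beta>\<langle>n\<rangle> E s = (if n = 0 then of_int s else 0) \<cdot> E (s - 1)"
  using E_\<beta>_commute[of s "-1" n \<one>] by (auto simp: algebra_simps)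

lemma c_\<beta>: "n \<ge> 0 \<Longrightarrow> c\<langle>n\<rangle> \<beta> = (if n = 1 then 2 else 0) \<cdot> E (-1)"
  by (simp add: \<beta>_def heisenberg c_c_commute[of n "-1"])

lemma d_\<beta>: "n \<ge> 0 \<Longrightarrow> d\<langle>n\<rangle> \<beta> = (if n = 0 then - \<beta> else if n = 1 then (1 / 2) \<cdot> E (-1) else 0)"
  by (auto simp: \<beta>_def heisenberg' d_d_commute[of n "-1"])

lemma c_\<beta>_commute: "c\<langle>m\<rangle> \<beta>\<langle>n\<rangle> v = \<beta>\<langle>n\<rangle> c\<langle>m\<rangle> v + (2 * of_int m) \<cdot> ((E (-1))\<langle>m + n - 1\<rangle> v)"
  by (subst commutator_trunc[of c False \<beta> False]) (simp_all add: psign_def c_\<beta>)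

lemma d_\<beta>_commute:
  "d\<langle>m\<rangle> \<beta>\<langle>n\<rangle> v = \<beta>\<langle>n\<rangle> d\<langle>m\<rangle> v - \<beta>\<langle>m + n\<rangle> v + (of_int m / 2) \<cdot> ((E (-1))\<langle>m + n - 1\<rangle> v)"
  by (subst commutator_trunc[of d False \<beta> False]) (simp_all add: psign_def d_\<beta>)

text \<open>The weight 1/4 in \<beta> originates here: with a weight s in its place, the product n =
  1 would be (4s - 1) E (-2). For n = 0 the vector \<beta>(-1) E (-1) is required; it is found by
  evaluating (E (-1))(-1) \<beta> in two ways.\<close>

lemma \<beta>_\<beta>:
  assumes "n \<ge> 0"
  shows "\<beta>\<langle>n\<rangle> \<beta> = 0"
proof -
  define u where "u = (1 / 4) \<cdot> (c\<langle>-1\<rangle> E (-2))"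
  have c_u: "c\<langle>-1\<rangle> E (-2) = 4 \<cdot> u"
    by (simp add: u_def)
  have b_b: "(E (-1))\<langle>-2\<rangle> E (-1) = - (2 \<cdot> u)"
    using E_nprod_E_minus2[of "-1" "-1"] by (simp add: c_u)
  have "(E (-1))\<langle>-1\<rangle> \<beta> = \<beta>\<langle>-1\<rangle> E (-1) - 4 \<cdot> u"
    using E_\<beta>_commute[of "-1" "-1" "-1" \<one>] E_nprod_E_minus2[of "-2" 0] by (simp add: c_u)
  moreover have "(E (-1))\<langle>-1\<rangle> d\<langle>-1\<rangle> E (-1) = d\<langle>-1\<rangle> E (-2) - 2 \<cdot> u"
    using d_E_commute[of "-1" "-1" "-1" "E (-1)"]
    by (simp add: b_b algebra_simps)
  moreover have "(E (-1))\<langle>-1\<rangle> \<beta> = (E (-1))\<langle>-1\<rangle> d\<langle>-1\<rangle> E (-1) + u"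
    by (simp add: \<beta>_def c_u flip: c_E_commute)
  ultimately have \<beta>_b: "\<beta>\<langle>-1\<rangle> E (-1) = d\<langle>-1\<rangle> E (-2) + 3 \<cdot> u"
    by (simp add: scale_numerals algebra_simps)
  have eq1: "\<beta>\<langle>n\<rangle> \<beta> = (\<beta>\<langle>n\<rangle> d\<langle>-1\<rangle> E (-1)) + (1 / 4) \<cdot> (\<beta>\<langle>n\<rangle> c\<langle>-1\<rangle> E (-1))"
    by (subst (2) \<beta>_def) simp
  have eq2: "\<beta>\<langle>n\<rangle> d\<langle>-1\<rangle> E (-1)
      = d\<langle>-1\<rangle> \<beta>\<langle>n\<rangle> E (-1) + \<beta>\<langle>n - 1\<rangle> E (-1) + (1 / 2) \<cdot> ((E (-1))\<langle>n - 2\<rangle> E (-1))"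
    using d_\<beta>_commute[of "-1" n "E (-1)"] by (simp add: algebra_simps)
  have eq3: "\<beta>\<langle>n\<rangle> c\<langle>-1\<rangle> E (-1) = c\<langle>-1\<rangle> \<beta>\<langle>n\<rangle> E (-1) + 2 \<cdot> ((E (-1))\<langle>n - 2\<rangle> E (-1))"
    using c_\<beta>_commute[of "-1" n "E (-1)"] by (simp add: algebra_simps)
  consider "n = 0" | "n = 1" | "n \<ge> 2"
    using assms by linarith
  then show ?thesis
  proof cases
    case 1
    then show ?thesis
      unfolding eq1 eq2 eq3
      by (simp add: \<beta>_E \<beta>_b b_b c_u vs.scale_right_distrib vs.scale_right_diff_distrib) (simp add: scale_numerals algebra_simps)
  next
    case 2
    then show ?thesis
      unfolding eq1 eq2 eq3 by (simp add: \<beta>_E)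
         (simp add: algebra_simps half_add_half)
  next
    case 3
    then show ?thesis
      unfolding eq1 eq2 eq3 by (simp add: \<beta>_E)
  qed
qed

end

section \<open>The critical realization\<close>

text \<open>Here \<open>\<rho>\<close> is \<open>\<i> G\<close>, \<open>\<kappa>\<close> is \<open>c/2\<close> and \<open>E s\<close> is \<open>e^(s c/2)\<close>.\<close>

locale critical_fields = vertex_superalgebra +
  fixes \<rho> \<Psi> T \<kappa> \<beta> :: 'a and E :: "int \<Rightarrow> 'a"
  assumes odd: "\<rho> \<in> part V True" "\<Psi> \<in> part V True"
    and even: "T \<in> part V False" "\<kappa> \<in> part V False" "\<beta> \<in> part V False" "E s \<in> part V False"
    and vac_E: "\<one> = E 0"
    and T_any: "n \<ge> 0 \<Longrightarrow> T\<langle>n\<rangle> v = 0"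
    and \<rho>_\<rho>: "n \<ge> 0 \<Longrightarrow> \<rho>\<langle>n\<rangle> \<rho> = (if n = 0 then (- 2) \<cdot> T else if n = 2 then 2 \<cdot> \<one> else 0)"
    and \<rho>_\<Psi>: "n \<ge> 0 \<Longrightarrow> \<rho>\<langle>n\<rangle> \<Psi> = 0"
    and \<rho>_\<beta>: "n \<ge> 0 \<Longrightarrow> \<rho>\<langle>n\<rangle> \<beta> = 0"
    and \<rho>_\<kappa>: "n \<ge> 0 \<Longrightarrow> \<rho>\<langle>n\<rangle> \<kappa> = 0"
    and \<rho>_E: "n \<ge> 0 \<Longrightarrow> \<rho>\<langle>n\<rangle> E s = 0"
    and \<Psi>_\<Psi>: "n \<ge> 0 \<Longrightarrow> \<Psi>\<langle>n\<rangle> \<Psi> = (if n = 0 then \<one> else 0)"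
    and \<Psi>_\<beta>: "n \<ge> 0 \<Longrightarrow> \<Psi>\<langle>n\<rangle> \<beta> = 0"
    and \<Psi>_\<kappa>: "n \<ge> 0 \<Longrightarrow> \<Psi>\<langle>n\<rangle> \<kappa> = 0"
    and \<Psi>_E: "n \<ge> 0 \<Longrightarrow> \<Psi>\<langle>n\<rangle> E s = 0"
    and \<beta>_\<beta>: "n \<ge> 0 \<Longrightarrow> \<beta>\<langle>n\<rangle> \<beta> = 0"
    and \<beta>_E: "n \<ge> 0 \<Longrightarrow> \<beta>\<langle>n\<rangle> E s = (if n = 0 then of_int s else 0) \<cdot> E (s - 1)"
    and \<kappa>_\<beta>: "n \<ge> 0 \<Longrightarrow> \<kappa>\<langle>n\<rangle> \<beta> = (if n = 1 then E (-1) else 0)"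
    and \<kappa>_\<kappa>: "n \<ge> 0 \<Longrightarrow> \<kappa>\<langle>n\<rangle> \<kappa> = 0"
    and \<kappa>_E: "n \<ge> 0 \<Longrightarrow> \<kappa>\<langle>n\<rangle> E s = 0"
    and E_E: "n \<ge> 0 \<Longrightarrow> (E s)\<langle>n\<rangle> E u = 0"
    and E_E_minus1: "(E s)\<langle>-1\<rangle> E u = E (s + u)"
    and E_E_minus2: "(E s)\<langle>-2\<rangle> E u = of_int s \<cdot> (\<kappa>\<langle>-1\<rangle> E (s + u))"
    and E_E_minus3: "(E s)\<langle>-3\<rangle> E u = (of_int s / 2) \<cdot> (\<kappa>\<langle>-2\<rangle> E (s + u))
      + (of_int s ^ 2 / 2) \<cdot> (\<kappa>\<langle>-1\<rangle> \<kappa>\<langle>-1\<rangle> E (s + u))"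
begin

lemma E_0_nprod: "(E 0)\<langle>n\<rangle> v = (if n = -1 then v else 0)"
  using vac_left[of n v] by (simp only: vac_E)

lemma nprod_E_0: "a\<langle>-1\<rangle> E 0 = a"
  using vac_right[of a] by (simp only: vac_E)

declare nprod_vac(2) [simp del]
declare E_E [simp] E_E_minus1 [simp] E_E_minus2 [simp] E_E_minus3 [simp] T_any [simp]
declare vac_E [simp] E_0_nprod [simp] \<rho>_E [simp] \<Psi>_E [simp] \<beta>_E [simp] \<kappa>_E [simp]
declare vs.scale_right_distrib [simp] vs.scale_right_diff_distrib [simp]

text \<open>The normal form for the simplifier: words of modes applied to some \<open>E s\<close> (hence \<open>E 0\<close> instead
  of \<open>\<one>\<close>), the modes of \<open>E\<close> and the annihilating ones moved to the right, the others ordered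
  \<open>\<rho>\<close>, \<open>\<Psi>\<close>, \<open>T\<close>, \<open>\<beta>\<close>, \<open>\<kappa>\<close>.\<close>

lemma \<rho>_\<rho>_comm: "\<rho>\<langle>m\<rangle> \<rho>\<langle>n\<rangle> v = - (\<rho>\<langle>n\<rangle> \<rho>\<langle>m\<rangle> v) - 2 \<cdot> (T\<langle>m + n\<rangle> v)
    + (if m + n = 1 then of_int (m * (m - 1)) else 0) \<cdot> v"
  by (subst commutator_trunc[OF odd(1) odd(1)]) (simp_all add: \<rho>_\<rho> psign_def)

lemma \<Psi>_\<Psi>_comm: "\<Psi>\<langle>m\<rangle> \<Psi>\<langle>n\<rangle> v = - (\<Psi>\<langle>n\<rangle> \<Psi>\<langle>m\<rangle> v) + (if m + n = -1 then 1 else 0) \<cdot> v"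
  by (subst commutator_trunc[OF odd(2) odd(2)]) (simp_all add: \<Psi>_\<Psi> psign_def)

text \<open>2n = -1 has no integer solution, so such a mode anticommutes with itself.\<close>

lemma \<Psi>_squared [simp]: "n < 0 \<Longrightarrow> \<Psi>\<langle>n\<rangle> \<Psi>\<langle>n\<rangle> v = 0"
proof -
  assume "n < 0"
  then have "(2::complex) \<cdot> (\<Psi>\<langle>n\<rangle> \<Psi>\<langle>n\<rangle> v) = 0"
    using \<Psi>_\<Psi>_comm[of n n v] by (simp add: scale_numerals eq_neg_iff_add_eq_0 del: vs.scale_eq_0_iff)
  then show ?thesis
    by simp
qed

lemma \<rho>_\<Psi>_comm: "\<rho>\<langle>m\<rangle> \<Psi>\<langle>n\<rangle> v = - (\<Psi>\<langle>n\<rangle> \<rho>\<langle>m\<rangle> v)"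
  by (subst commutator_trunc[OF odd(1) odd(2)]) (simp_all add: \<rho>_\<Psi> psign_def)

lemma \<rho>_\<beta>_comm: "\<rho>\<langle>m\<rangle> \<beta>\<langle>n\<rangle> v = \<beta>\<langle>n\<rangle> \<rho>\<langle>m\<rangle> v"
  by (subst commutator_trunc[OF odd(1) even(3)]) (simp_all add: \<rho>_\<beta> psign_def)

lemma \<rho>_\<kappa>_comm: "\<rho>\<langle>m\<rangle> \<kappa>\<langle>n\<rangle> v = \<kappa>\<langle>n\<rangle> \<rho>\<langle>m\<rangle> v"
  by (subst commutator_trunc[OF odd(1) even(2)]) (simp_all add: \<rho>_\<kappa> psign_def)

lemma \<rho>_E_comm: "\<rho>\<langle>m\<rangle> (E s)\<langle>n\<rangle> v = (E s)\<langle>n\<rangle> \<rho>\<langle>m\<rangle> v"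
  by (subst commutator_trunc[OF odd(1) even(4)]) (simp_all add: psign_def)

lemma \<Psi>_\<beta>_comm: "\<Psi>\<langle>m\<rangle> \<beta>\<langle>n\<rangle> v = \<beta>\<langle>n\<rangle> \<Psi>\<langle>m\<rangle> v"
  by (subst commutator_trunc[OF odd(2) even(3)]) (simp_all add: \<Psi>_\<beta> psign_def)

lemma \<Psi>_\<kappa>_comm: "\<Psi>\<langle>m\<rangle> \<kappa>\<langle>n\<rangle> v = \<kappa>\<langle>n\<rangle> \<Psi>\<langle>m\<rangle> v"
  by (subst commutator_trunc[OF odd(2) even(2)]) (simp_all add: \<Psi>_\<kappa> psign_def)

lemma \<Psi>_E_comm: "\<Psi>\<langle>m\<rangle> (E s)\<langle>n\<rangle> v = (E s)\<langle>n\<rangle> \<Psi>\<langle>m\<rangle> v"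
  by (subst commutator_trunc[OF odd(2) even(4)]) (simp_all add: psign_def)

lemma \<beta>_\<beta>_comm: "\<beta>\<langle>m\<rangle> \<beta>\<langle>n\<rangle> v = \<beta>\<langle>n\<rangle> \<beta>\<langle>m\<rangle> v"
  by (subst commutator_trunc[OF even(3) even(3)]) (simp_all add: \<beta>_\<beta> psign_def)

lemma \<beta>_E_comm: "\<beta>\<langle>m\<rangle> (E s)\<langle>n\<rangle> v = (E s)\<langle>n\<rangle> \<beta>\<langle>m\<rangle> v + of_int s \<cdot> ((E (s - 1))\<langle>m + n\<rangle> v)"
  by (subst commutator_trunc[OF even(3) even(4)]) (simp_all add: psign_def)

lemma \<kappa>_\<kappa>_comm: "\<kappa>\<langle>m\<rangle> \<kappa>\<langle>n\<rangle> v = \<kappa>\<langle>n\<rangle> \<kappa>\<langle>m\<rangle> v"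
  by (subst commutator_trunc[OF even(2) even(2)]) (simp_all add: \<kappa>_\<kappa> psign_def)

lemma \<kappa>_\<beta>_comm: "\<kappa>\<langle>m\<rangle> \<beta>\<langle>n\<rangle> v = \<beta>\<langle>n\<rangle> \<kappa>\<langle>m\<rangle> v + of_int m \<cdot> ((E (-1))\<langle>m + n - 1\<rangle> v)"
  by (subst commutator_trunc[OF even(2) even(3)]) (simp_all add: \<kappa>_\<beta> psign_def)

lemma \<kappa>_E_comm: "\<kappa>\<langle>m\<rangle> (E s)\<langle>n\<rangle> v = (E s)\<langle>n\<rangle> \<kappa>\<langle>m\<rangle> v"
  by (subst commutator_trunc[OF even(2) even(4)]) (simp_all add: psign_def)

lemma T_comm: "T\<langle>m\<rangle> a\<langle>n\<rangle> v = a\<langle>n\<rangle> T\<langle>m\<rangle> v"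
proof -
  have "T\<langle>m\<rangle> a\<langle>n\<rangle> v = a\<langle>n\<rangle> T\<langle>m\<rangle> v" if "a \<in> part V p" for a p
    by (subst commutator_trunc[OF even(1) that]) (simp_all add: psign_def)
  moreover obtain a0 a1 where "a = a0 + a1" "a0 \<in> part V False" "a1 \<in> part V True"
    by (rule homogeneous_cases)
  ultimately show ?thesis
    by simp
qed

lemmas E_right = \<rho>_E_comm[symmetric] \<Psi>_E_comm[symmetric] \<kappa>_E_comm[symmetric] T_comm[of _ "E _", symmetric]

lemma E_\<beta>_comm: "(E s)\<langle>n\<rangle> \<beta>\<langle>m\<rangle> v = \<beta>\<langle>m\<rangle> (E s)\<langle>n\<rangle> v - of_int s \<cdot> ((E (s - 1))\<langle>m + n\<rangle> v)"
  by (simp add: \<beta>_E_comm)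

lemma annihilators_right:
  assumes "m \<ge> 0" "n < 0"
  shows "\<rho>\<langle>m\<rangle> \<rho>\<langle>n\<rangle> v = - (\<rho>\<langle>n\<rangle> \<rho>\<langle>m\<rangle> v) - 2 \<cdot> (T\<langle>m + n\<rangle> v)
      + (if m + n = 1 then of_int (m * (m - 1)) else 0) \<cdot> v"
    and "\<Psi>\<langle>m\<rangle> \<Psi>\<langle>n\<rangle> v = - (\<Psi>\<langle>n\<rangle> \<Psi>\<langle>m\<rangle> v) + (if m + n = -1 then 1 else 0) \<cdot> v"
    and "\<rho>\<langle>m\<rangle> \<Psi>\<langle>n\<rangle> v = - (\<Psi>\<langle>n\<rangle> \<rho>\<langle>m\<rangle> v)"
    and "\<rho>\<langle>m\<rangle> \<beta>\<langle>n\<rangle> v = \<beta>\<langle>n\<rangle> \<rho>\<langle>m\<rangle> v"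
    and "\<rho>\<langle>m\<rangle> \<kappa>\<langle>n\<rangle> v = \<kappa>\<langle>n\<rangle> \<rho>\<langle>m\<rangle> v"
    and "\<rho>\<langle>m\<rangle> T\<langle>n\<rangle> v = T\<langle>n\<rangle> \<rho>\<langle>m\<rangle> v"
    and "\<Psi>\<langle>m\<rangle> \<beta>\<langle>n\<rangle> v = \<beta>\<langle>n\<rangle> \<Psi>\<langle>m\<rangle> v"
    and "\<Psi>\<langle>m\<rangle> \<kappa>\<langle>n\<rangle> v = \<kappa>\<langle>n\<rangle> \<Psi>\<langle>m\<rangle> v"
    and "\<Psi>\<langle>m\<rangle> T\<langle>n\<rangle> v = T\<langle>n\<rangle> \<Psi>\<langle>m\<rangle> v"
    and "\<beta>\<langle>m\<rangle> \<kappa>\<langle>n\<rangle> v = \<kappa>\<langle>n\<rangle> \<beta>\<langle>m\<rangle> v - of_int n \<cdot> ((E (-1))\<langle>m + n - 1\<rangle> v)"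
  by (fact \<rho>_\<rho>_comm \<Psi>_\<Psi>_comm \<rho>_\<Psi>_comm \<rho>_\<beta>_comm \<rho>_\<kappa>_comm T_comm[symmetric] \<Psi>_\<beta>_comm \<Psi>_\<kappa>_comm
     | simp add: \<kappa>_\<beta>_comm add.commute)+

text \<open>The excluded case m < 0 \<le> n is the order that \<open>annihilators_right\<close>
  produces; without the premise the two sets of equations would undo each other.\<close>

lemma sort_modes:
  assumes "m \<ge> 0 \<or> n < 0"
  shows "\<Psi>\<langle>m\<rangle> \<rho>\<langle>n\<rangle> v = - (\<rho>\<langle>n\<rangle> \<Psi>\<langle>m\<rangle> v)"
    and "\<beta>\<langle>m\<rangle> \<rho>\<langle>n\<rangle> v = \<rho>\<langle>n\<rangle> \<beta>\<langle>m\<rangle> v"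
    and "\<kappa>\<langle>m\<rangle> \<rho>\<langle>n\<rangle> v = \<rho>\<langle>n\<rangle> \<kappa>\<langle>m\<rangle> v"
    and "\<beta>\<langle>m\<rangle> \<Psi>\<langle>n\<rangle> v = \<Psi>\<langle>n\<rangle> \<beta>\<langle>m\<rangle> v"
    and "\<kappa>\<langle>m\<rangle> \<Psi>\<langle>n\<rangle> v = \<Psi>\<langle>n\<rangle> \<kappa>\<langle>m\<rangle> v"
    and "\<kappa>\<langle>m\<rangle> \<beta>\<langle>n\<rangle> v = \<beta>\<langle>n\<rangle> \<kappa>\<langle>m\<rangle> v + of_int m \<cdot> ((E (-1))\<langle>m + n - 1\<rangle> v)"
  by (simp_all add: \<rho>_\<Psi>_comm \<rho>_\<beta>_comm \<rho>_\<kappa>_comm \<Psi>_\<beta>_comm \<Psi>_\<kappa>_comm \<kappa>_\<beta>_comm)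

lemma annihilators_right_T: "\<beta>\<langle>m\<rangle> T\<langle>n\<rangle> v = T\<langle>n\<rangle> \<beta>\<langle>m\<rangle> v" "\<kappa>\<langle>m\<rangle> T\<langle>n\<rangle> v = T\<langle>n\<rangle> \<kappa>\<langle>m\<rangle> v"
  by (simp_all add: T_comm)

text \<open>The numerals keep the simplifier from treating these equations as permutative.\<close>

lemma sort_equal:
  "\<Psi>\<langle>-2\<rangle> \<Psi>\<langle>-1\<rangle> v = - (\<Psi>\<langle>-1\<rangle> \<Psi>\<langle>-2\<rangle> v)"
  "m \<ge> 0 \<or> m = -2 \<Longrightarrow> \<beta>\<langle>m\<rangle> \<beta>\<langle>-1\<rangle> v = \<beta>\<langle>-1\<rangle> \<beta>\<langle>m\<rangle> v"
  "m \<ge> 0 \<Longrightarrow> \<beta>\<langle>m\<rangle> \<beta>\<langle>-2\<rangle> v = \<beta>\<langle>-2\<rangle> \<beta>\<langle>m\<rangle> v"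
  "m \<ge> 0 \<or> m = -2 \<Longrightarrow> \<kappa>\<langle>m\<rangle> \<kappa>\<langle>-1\<rangle> v = \<kappa>\<langle>-1\<rangle> \<kappa>\<langle>m\<rangle> v"
  using \<Psi>_\<Psi>_comm[of "-2" "-1" v] \<beta>_\<beta>_comm \<kappa>_\<kappa>_comm by simp_all

declare E_right [simp] E_\<beta>_comm [simp] annihilators_right [simp] sort_modes [simp]
  annihilators_right_T [simp] sort_equal [simp]

text \<open>In the iterate formula the hypothesis on \<open>A\<close> removes the second half, and
  the one on \<open>E s\<close> leaves j = 0 and j = 1 of the first. The weight 2 is minus the
  binomial coefficient of -2 over 1.\<close>

lemma composite_nprod:
  assumes A: "A \<in> part V p" "\<And>j. j \<ge> 0 \<Longrightarrow> A\<langle>j\<rangle> v = 0"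
    and E: "\<And>j. j \<ge> n + 2 \<Longrightarrow> (E s)\<langle>j\<rangle> v = 0"
  shows "(A\<langle>-1\<rangle> E s)\<langle>n\<rangle> v = (A\<langle>-1\<rangle> (E s)\<langle>n\<rangle> v) + (A\<langle>-2\<rangle> (E s)\<langle>n + 1\<rangle> v)"
    and "(A\<langle>-2\<rangle> E s)\<langle>n\<rangle> v = (A\<langle>-2\<rangle> (E s)\<langle>n\<rangle> v) + 2 \<cdot> (A\<langle>-3\<rangle> (E s)\<langle>n + 1\<rangle> v)"
proof -
  have sum: "(A\<langle>i\<rangle> E s)\<langle>n\<rangle> v = (\<Sum>j\<in>{0,1::nat}. ((-1) ^ j * (of_int i gchoose j)) \<cdot>
           (A\<langle>i - int j\<rangle> (E s)\<langle>n + int j\<rangle> v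
            - ((-1) powi i * psign p False) \<cdot> ((E s)\<langle>i + n - int j\<rangle> A\<langle>int j\<rangle> v)))" for i
    unfolding iterate[OF A(1) even(4)]
  proof (rule Sum_any.expand_superset)
    show "{j. ((-1) ^ j * (of_int i gchoose j)) \<cdot> (A\<langle>i - int j\<rangle> (E s)\<langle>n + int j\<rangle> v
        - ((-1) powi i * psign p False) \<cdot> ((E s)\<langle>i + n - int j\<rangle> A\<langle>int j\<rangle> v)) \<noteq> 0} \<subseteq> {0, 1}"
    proof
      fix j
      assume j: "j \<in> {j. ((-1) ^ j * (of_int i gchoose j)) \<cdot> (A\<langle>i - int j\<rangle> (E s)\<langle>n + int j\<rangle> v
        - ((-1) powi i * psign p False) \<cdot> ((E s)\<langle>i + n - int j\<rangle> A\<langle>int j\<rangle> v)) \<noteq> 0}"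
      show "j \<in> {0, 1}"
      proof (rule ccontr)
        assume "j \<notin> {0, 1}"
        then have "(E s)\<langle>n + int j\<rangle> v = 0"
          by (intro E) auto
        with j A(2)[of "int j"] show False
          by simp
      qed
    qed
  qed simp
  show "(A\<langle>-1\<rangle> E s)\<langle>n\<rangle> v = (A\<langle>-1\<rangle> (E s)\<langle>n\<rangle> v) + (A\<langle>-2\<rangle> (E s)\<langle>n + 1\<rangle> v)"
    and "(A\<langle>-2\<rangle> E s)\<langle>n\<rangle> v = (A\<langle>-2\<rangle> (E s)\<langle>n\<rangle> v) + 2 \<cdot> (A\<langle>-3\<rangle> (E s)\<langle>n + 1\<rangle> v)"
    unfolding sum using A(2)[of 0] A(2)[of 1] by simp_all
qed

section \<open>The odd fields x and y and their commutators with the generators\<close>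

definition x :: 'a where "x = \<Psi>\<langle>-1\<rangle> E 1"

text \<open>The third summand is -\<Psi> D(E (-1)), because D(E (-1)) = -\<kappa>(-1) E
  (-1).\<close>

definition y :: 'a where
  "y = \<rho>\<langle>-1\<rangle> E (-1) + (\<Psi>\<langle>-1\<rangle> \<beta>\<langle>-1\<rangle> E 0) + (\<Psi>\<langle>-1\<rangle> \<kappa>\<langle>-1\<rangle> E (-1)) - 2 \<cdot> (\<Psi>\<langle>-2\<rangle> E (-1))"

lemma x_odd: "x \<in> part V True"
  using nprod_parity[OF odd(2) even(4)] by (simp add: x_def)

lemma y_odd: "y \<in> part V True"
proof -
  have "\<rho>\<langle>-1\<rangle> E (-1) \<in> part V True" "\<Psi>\<langle>-2\<rangle> E (-1) \<in> part V True"
    using nprod_parity[OF odd(1) even(4)] nprod_parity[OF odd(2) even(4)] by simp_all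
  moreover have "\<Psi>\<langle>-1\<rangle> \<beta>\<langle>-1\<rangle> E 0 \<in> part V True" "\<Psi>\<langle>-1\<rangle> \<kappa>\<langle>-1\<rangle> E (-1) \<in> part V True"
    using nprod_parity[OF odd(2) nprod_parity[OF even(3) even(4)]]
      nprod_parity[OF odd(2) nprod_parity[OF even(2) even(4)]] by simp_all
  ultimately show ?thesis
    unfolding y_def using part_subspace[of True]
    by (intro vs.subspace_diff vs.subspace_add vs.subspace_scale)
qed

text \<open>Generators acting on x are evaluated directly in normal form. The commutator formula,
  solved for the opposite order, then yields \<open>x_generators\<close>; y and h are treated
  alike.\<close>

lemma generators_x:
  assumes "n \<ge> 0"
  shows "\<rho>\<langle>n\<rangle> x = 0" "\<Psi>\<langle>n\<rangle> x = (if n = 0 then E 1 else 0)"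
    "\<beta>\<langle>n\<rangle> x = (if n = 0 then \<Psi> else 0)" "\<kappa>\<langle>n\<rangle> x = 0" "(E s)\<langle>n\<rangle> x = 0"
  using assms by (simp_all add: x_def nprod_E_0)

lemma x_generators:
  "x\<langle>n\<rangle> \<rho>\<langle>m\<rangle> v = - (\<rho>\<langle>m\<rangle> x\<langle>n\<rangle> v)"
  "x\<langle>n\<rangle> \<Psi>\<langle>m\<rangle> v = - (\<Psi>\<langle>m\<rangle> x\<langle>n\<rangle> v) + (E 1)\<langle>m + n\<rangle> v"
  "x\<langle>n\<rangle> \<beta>\<langle>m\<rangle> v = \<beta>\<langle>m\<rangle> x\<langle>n\<rangle> v - (\<Psi>\<langle>m + n\<rangle> v)"
  "x\<langle>n\<rangle> \<kappa>\<langle>m\<rangle> v = \<kappa>\<langle>m\<rangle> x\<langle>n\<rangle> v"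
  "x\<langle>n\<rangle> (E s)\<langle>m\<rangle> v = (E s)\<langle>m\<rangle> x\<langle>n\<rangle> v"
  using commutator_trunc[OF odd(1) x_odd, of m n v] commutator_trunc[OF odd(2) x_odd, of m n v]
    commutator_trunc[OF even(3) x_odd, of m n v] commutator_trunc[OF even(2) x_odd, of m n v]
    commutator_trunc[OF even(4) x_odd, of s m n v]
  by (simp_all add: generators_x psign_def)

lemma x_E: "n \<ge> 0 \<Longrightarrow> x\<langle>n\<rangle> E s = 0" "x\<langle>-1\<rangle> E s = \<Psi>\<langle>-1\<rangle> E (s + 1)"
proof -
  have 1: "x\<langle>n\<rangle> E s = (E s)\<langle>-1\<rangle> x\<langle>n\<rangle> \<one>" for n
    using x_generators(5)[of n s "-1" "E 0"] by simp
  show "n \<ge> 0 \<Longrightarrow> x\<langle>n\<rangle> E s = 0"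
    unfolding 1 by (simp del: vac_E)
  show "x\<langle>-1\<rangle> E s = \<Psi>\<langle>-1\<rangle> E (s + 1)"
    unfolding 1 vac_right by (simp add: x_def)
qed

lemma E_derivative: "of_int s \<cdot> ((\<kappa>\<langle>-1\<rangle> E s)\<langle>k\<rangle> v) = (- of_int k) \<cdot> ((E s)\<langle>k - 1\<rangle> v)"
  using translation[of "E s" k v] by simp

lemma \<kappa>_b: "(\<kappa>\<langle>-1\<rangle> E (-1))\<langle>k\<rangle> v = of_int k \<cdot> ((E (-1))\<langle>k - 1\<rangle> v)"
  using E_derivative[of "-1" k v] by simp

text \<open>In \<beta>(0)y the derivative of \<Psi>(-1) E (-2) is split off so that
  \<open>translation\<close> merges it with the contribution of \<beta>(1)y, leaving the single
  factor n in \<open>y_generators\<close>.\<close>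

lemma generators_y:
  assumes "n \<ge> 0"
  shows "\<rho>\<langle>n\<rangle> y = (if n = 0 then (- 2) \<cdot> (T\<langle>-1\<rangle> E (-1)) else if n = 2 then 2 \<cdot> E (-1) else 0)"
    "\<Psi>\<langle>n\<rangle> y = (if n = 0 then \<beta> + \<kappa>\<langle>-1\<rangle> E (-1) else if n = 1 then (- 2) \<cdot> E (-1) else 0)"
    "\<beta>\<langle>n\<rangle> y = (if n = 0 then - (\<rho>\<langle>-1\<rangle> E (-2)) + (\<Psi>\<langle>-1\<rangle> E (-2))\<langle>-2\<rangle> \<one> + \<Psi>\<langle>-2\<rangle> E (-2)
       else if n = 1 then \<Psi>\<langle>-1\<rangle> E (-2) else 0)"
    "(E s)\<langle>n\<rangle> y = (if n = 0 then (- of_int s) \<cdot> (\<Psi>\<langle>-1\<rangle> E (s - 1)) else 0)"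
proof -
  consider "n = 0" | "n = 1" | "n = 2" | "n \<ge> 3"
    using assms by linarith
  note cases_n = this
  show "\<rho>\<langle>n\<rangle> y = (if n = 0 then (- 2) \<cdot> (T\<langle>-1\<rangle> E (-1)) else if n = 2 then 2 \<cdot> E (-1) else 0)"
    using cases_n by cases (simp_all add: y_def)
  show "\<Psi>\<langle>n\<rangle> y = (if n = 0 then \<beta> + \<kappa>\<langle>-1\<rangle> E (-1) else if n = 1 then (- 2) \<cdot> E (-1) else 0)"
    using cases_n by cases (simp_all add: y_def nprod_E_0 \<Psi>_\<beta>)
  show "(E s)\<langle>n\<rangle> y = (if n = 0 then (- of_int s) \<cdot> (\<Psi>\<langle>-1\<rangle> E (s - 1)) else 0)"
    using cases_n by cases (simp_all add: y_def)
  have Z: "(\<Psi>\<langle>-1\<rangle> E (-2))\<langle>-2\<rangle> E 0 = \<Psi>\<langle>-2\<rangle> E (-2) - 2 \<cdot> (\<Psi>\<langle>-1\<rangle> \<kappa>\<langle>-1\<rangle> E (-2))"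
    by (subst composite_nprod[OF odd(2)]) simp_all
  show "\<beta>\<langle>n\<rangle> y = (if n = 0 then - (\<rho>\<langle>-1\<rangle> E (-2)) + (\<Psi>\<langle>-1\<rangle> E (-2))\<langle>-2\<rangle> \<one> + \<Psi>\<langle>-2\<rangle> E (-2)
       else if n = 1 then \<Psi>\<langle>-1\<rangle> E (-2) else 0)"
    using cases_n by cases (simp_all add: y_def Z scale_numerals algebra_simps)
qed

lemma y_generators:
  "y\<langle>n\<rangle> \<rho>\<langle>m\<rangle> v = - (\<rho>\<langle>m\<rangle> y\<langle>n\<rangle> v) - 2 \<cdot> ((T\<langle>-1\<rangle> E (-1))\<langle>m + n\<rangle> v)
    + of_int (m * (m - 1)) \<cdot> ((E (-1))\<langle>m + n - 2\<rangle> v)"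
  "y\<langle>n\<rangle> \<Psi>\<langle>m\<rangle> v = - (\<Psi>\<langle>m\<rangle> y\<langle>n\<rangle> v) + \<beta>\<langle>m + n\<rangle> v + of_int (n - m) \<cdot> ((E (-1))\<langle>m + n - 1\<rangle> v)"
  "y\<langle>n\<rangle> \<beta>\<langle>m\<rangle> v = \<beta>\<langle>m\<rangle> y\<langle>n\<rangle> v + (\<rho>\<langle>-1\<rangle> E (-2))\<langle>m + n\<rangle> v - ((\<Psi>\<langle>-2\<rangle> E (-2))\<langle>m + n\<rangle> v)
    + of_int n \<cdot> ((\<Psi>\<langle>-1\<rangle> E (-2))\<langle>m + n - 1\<rangle> v)"
  "y\<langle>n\<rangle> (E s)\<langle>m\<rangle> v = (E s)\<langle>m\<rangle> y\<langle>n\<rangle> v + of_int s \<cdot> ((\<Psi>\<langle>-1\<rangle> E (s - 1))\<langle>m + n\<rangle> v)"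
proof -
  show "y\<langle>n\<rangle> \<rho>\<langle>m\<rangle> v = - (\<rho>\<langle>m\<rangle> y\<langle>n\<rangle> v) - 2 \<cdot> ((T\<langle>-1\<rangle> E (-1))\<langle>m + n\<rangle> v)
    + of_int (m * (m - 1)) \<cdot> ((E (-1))\<langle>m + n - 2\<rangle> v)"
    using commutator_trunc[OF odd(1) y_odd, of m n v] by (simp add: generators_y psign_def)
  have "(of_int m * 2) \<cdot> u = of_int m \<cdot> u + of_int m \<cdot> u" for u
    by (metis mult_2_right vs.scale_left_distrib)
  then show "y\<langle>n\<rangle> \<Psi>\<langle>m\<rangle> v = - (\<Psi>\<langle>m\<rangle> y\<langle>n\<rangle> v) + \<beta>\<langle>m + n\<rangle> v + of_int (n - m) \<cdot> ((E (-1))\<langle>m + n - 1\<rangle> v)"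
    using commutator_trunc[OF odd(2) y_odd, of m n v]
    by (simp add: generators_y psign_def \<kappa>_b vs.scale_left_distrib vs.scale_left_diff_distrib)
  show "y\<langle>n\<rangle> \<beta>\<langle>m\<rangle> v = \<beta>\<langle>m\<rangle> y\<langle>n\<rangle> v + (\<rho>\<langle>-1\<rangle> E (-2))\<langle>m + n\<rangle> v - ((\<Psi>\<langle>-2\<rangle> E (-2))\<langle>m + n\<rangle> v)
    + of_int n \<cdot> ((\<Psi>\<langle>-1\<rangle> E (-2))\<langle>m + n - 1\<rangle> v)"
    using commutator_trunc[OF even(3) y_odd, of m n v]
    by (simp add: generators_y psign_def translation vs.scale_left_distrib vs.scale_left_diff_distrib del: vac_E)
  show "y\<langle>n\<rangle> (E s)\<langle>m\<rangle> v = (E s)\<langle>m\<rangle> y\<langle>n\<rangle> v + of_int s \<cdot> ((\<Psi>\<langle>-1\<rangle> E (s - 1))\<langle>m + n\<rangle> v)"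
    using commutator_trunc[OF even(4) y_odd, of s m n v] by (simp add: generators_y psign_def)
qed

lemmas composites =
  composite_nprod[OF odd(1)] composite_nprod[OF odd(2)] composite_nprod[OF even(1)]

lemma nprod_E_0_nonneg: "k \<ge> 0 \<Longrightarrow> u\<langle>k\<rangle> E 0 = 0"
  using nprod_vac(1)[of k u] by simp

lemma y_E:
  "n \<ge> 0 \<Longrightarrow> y\<langle>n\<rangle> E s = (if n = 0 then of_int s \<cdot> (\<Psi>\<langle>-1\<rangle> E (s - 1)) else 0)"
  using y_generators(4)[of n s "-1" "E 0"]
  by (cases "n = 0") (simp_all add: nprod_E_0 nprod_E_0_nonneg)

text \<open>Since \<kappa>(-1) E (-1) = -(E (-1))(-2) E 0, the modes of y only have to pass a mode
  of E instead of one of \<kappa>.\<close>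

lemma y_\<kappa>b:
  assumes "n \<ge> 0"
  shows "y\<langle>n\<rangle> \<kappa>\<langle>-1\<rangle> E (-1) = (if n = 0 then \<Psi>\<langle>-2\<rangle> E (-2) - 2 \<cdot> (\<Psi>\<langle>-1\<rangle> \<kappa>\<langle>-1\<rangle> E (-2))
    else if n = 1 then \<Psi>\<langle>-1\<rangle> E (-2) else 0)"
proof -
  consider "n = 0" | "n = 1" | "n \<ge> 2"
    using assms by linarith
  then show ?thesis
    using y_generators(4)[of n "-1" "-2" "E 0"] assms
    by cases (simp_all add: y_E composites algebra_simps)
qed

section \<open>Products of x, y, h and f with one another\<close>

lemma x_x: "n \<ge> 0 \<Longrightarrow> x\<langle>n\<rangle> x = (if n = 0 then E 2 else 0)"
  by (subst (2) x_def) (auto simp: x_generators x_E)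

definition h :: 'a where "h = \<beta>\<langle>-1\<rangle> E 1 - \<kappa>\<langle>-1\<rangle> E 0"

text \<open>The generators \<open>e\<close> and \<open>f\<close> of osp(1,2) are \<open>(1/2) \<cdot> E 2\<close> and \<open>(-1/2) \<cdot> f\<close>.\<close>

definition f :: 'a where
  "f = (\<beta>\<langle>-1\<rangle> \<beta>\<langle>-1\<rangle> E 0) - 2 \<cdot> (\<beta>\<langle>-2\<rangle> E (-1)) + 2 \<cdot> (\<rho>\<langle>-1\<rangle> \<Psi>\<langle>-1\<rangle> E (-2))
    + 2 \<cdot> (\<Psi>\<langle>-1\<rangle> \<Psi>\<langle>-2\<rangle> E (-2)) - 2 \<cdot> (T\<langle>-1\<rangle> E (-2))"

text \<open>The value -3 = (x,y) k fixes the level. It is the sum of -1 from \<Psi>\<beta>, through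
  (E 1)(0)\<beta>, and -2 from the term -2 D(\<Psi>) E (-1).\<close>

lemma x_y:
  assumes "n \<ge> 0"
  shows "x\<langle>n\<rangle> y = (if n = 0 then h else if n = 1 then (- 3) \<cdot> \<one> else 0)"
proof -
  consider "n = 0" | "n = 1" | "n \<ge> 2"
    using assms by linarith
  then show ?thesis
    by cases (simp_all add: y_def h_def x_generators x_E scale_numerals algebra_simps)
qed

text \<open>For n = 2 the four summands of the right-hand y contribute 2, 3, 1 and -6 times E (-2).
  The first comes from \<rho>(2)\<rho> and would be -2 without the factor \<i> in \<rho>.\<close>

lemma y_y:
  assumes "n \<ge> 0"
  shows "y\<langle>n\<rangle> y = (if n = 0 then f else 0)"
proof -
  have y: "y\<langle>n\<rangle> y = y\<langle>n\<rangle> \<rho>\<langle>-1\<rangle> E (-1) + (y\<langle>n\<rangle> \<Psi>\<langle>-1\<rangle> \<beta>\<langle>-1\<rangle> E 0) + (y\<langle>n\<rangle> \<Psi>\<langle>-1\<rangle> \<kappa>\<langle>-1\<rangle> E (-1))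
      - 2 \<cdot> (y\<langle>n\<rangle> \<Psi>\<langle>-2\<rangle> E (-1))"
    by (subst (2) y_def) (simp only: nprod_simps)
  consider "n = 0" | "n = 1" | "n = 2" | "n \<ge> 3"
    using assms by linarith
  then show ?thesis
    unfolding y
    by cases (simp_all add: f_def y_generators y_E y_\<kappa>b composites scale_numerals algebra_simps)
qed

lemma y_T: "y\<langle>n\<rangle> T\<langle>m\<rangle> v = T\<langle>m\<rangle> y\<langle>n\<rangle> v"
  by (simp add: T_comm)

text \<open>Only n \<ge> 1 is calculated; for n = 0 a symmetry argument in \<open>f_y_comm\<close>
  suffices.\<close>

lemma y_f:
  assumes "n \<ge> 1"
  shows "y\<langle>n\<rangle> f = 0"
proof -
  consider "n = 1" | "n = 2" | "n \<ge> 3"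
    using assms by linarith
  then show ?thesis
    unfolding f_def
    by cases (simp_all add: y_generators y_T y_E composites scale_numerals algebra_simps)
qed

lemma generators_h:
  assumes "n \<ge> 0"
  shows "\<rho>\<langle>n\<rangle> h = 0" "\<Psi>\<langle>n\<rangle> h = 0"
    "\<beta>\<langle>n\<rangle> h = (if n = 0 then \<beta>\<langle>-1\<rangle> E 0 + \<kappa>\<langle>-1\<rangle> E (-1) else if n = 1 then - E (-1) else 0)"
    "\<kappa>\<langle>n\<rangle> h = (if n = 1 then \<one> else 0)"
    "(E s)\<langle>n\<rangle> h = (if n = 0 then (- of_int s) \<cdot> E s else 0)"
proof -
  consider "n = 0" | "n = 1" | "n \<ge> 2"
    using assms by linarith
  then show "\<rho>\<langle>n\<rangle> h = 0" "\<Psi>\<langle>n\<rangle> h = 0"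
    "\<beta>\<langle>n\<rangle> h = (if n = 0 then \<beta>\<langle>-1\<rangle> E 0 + \<kappa>\<langle>-1\<rangle> E (-1) else if n = 1 then - E (-1) else 0)"
    "\<kappa>\<langle>n\<rangle> h = (if n = 1 then \<one> else 0)"
    "(E s)\<langle>n\<rangle> h = (if n = 0 then (- of_int s) \<cdot> E s else 0)"
    by (cases; simp add: h_def scale_numerals algebra_simps)+
qed

lemma h_even: "h \<in> part V False"
  using nprod_parity[OF x_odd y_odd, of 0] by (simp add: x_y)

lemma h_generators:
  "h\<langle>n\<rangle> \<rho>\<langle>m\<rangle> v = \<rho>\<langle>m\<rangle> h\<langle>n\<rangle> v"
  "h\<langle>n\<rangle> \<Psi>\<langle>m\<rangle> v = \<Psi>\<langle>m\<rangle> h\<langle>n\<rangle> v"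
  "h\<langle>n\<rangle> \<beta>\<langle>m\<rangle> v = \<beta>\<langle>m\<rangle> h\<langle>n\<rangle> v - \<beta>\<langle>m + n\<rangle> v - of_int n \<cdot> ((E (-1))\<langle>m + n - 1\<rangle> v)"
  "h\<langle>n\<rangle> \<kappa>\<langle>m\<rangle> v = \<kappa>\<langle>m\<rangle> h\<langle>n\<rangle> v - (if m + n = 0 then of_int m else 0) \<cdot> v"
  "h\<langle>n\<rangle> (E s)\<langle>m\<rangle> v = (E s)\<langle>m\<rangle> h\<langle>n\<rangle> v + of_int s \<cdot> ((E s)\<langle>m + n\<rangle> v)"
  using commutator_trunc[OF odd(1) h_even, of m n v] commutator_trunc[OF odd(2) h_even, of m n v]
    commutator_trunc[OF even(3) h_even, of m n v] commutator_trunc[OF even(2) h_even, of m n v]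
    commutator_trunc[OF even(4) h_even, of s m n v]
  by (simp_all add: generators_h nprod_E_0 psign_def \<kappa>_b vs.scale_left_distrib vs.scale_left_diff_distrib)

lemma h_E: "n \<ge> 0 \<Longrightarrow> h\<langle>n\<rangle> E s = (if n = 0 then of_int s \<cdot> E s else 0)"
  using h_generators(5)[of n s "-1" "E 0"] by (cases "n = 0") (simp_all add: nprod_E_0_nonneg)

lemma h_x: "n \<ge> 0 \<Longrightarrow> h\<langle>n\<rangle> x = (if n = 0 then x else 0)"
  by (auto simp: x_def h_generators h_E)

lemma h_y:
  assumes "n \<ge> 0"
  shows "h\<langle>n\<rangle> y = (if n = 0 then - y else 0)"
proof -
  consider "n = 0" | "n = 1" | "n \<ge> 2"
    using assms by linarith
  then show ?thesis
    by cases (simp_all add: y_def h_generators h_E scale_numerals algebra_simps)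
qed

lemma h_h:
  assumes "n \<ge> 0"
  shows "h\<langle>n\<rangle> h = (if n = 1 then (- 3) \<cdot> \<one> else 0)"
proof -
  have h: "h\<langle>n\<rangle> h = h\<langle>n\<rangle> \<beta>\<langle>-1\<rangle> E 1 - (h\<langle>n\<rangle> \<kappa>\<langle>-1\<rangle> E 0)"
    by (subst (2) h_def) (simp only: nprod_simps)
  consider "n = 0" | "n = 1" | "n \<ge> 2"
    using assms by linarith
  then show ?thesis
    unfolding h
    by cases (simp_all add: h_generators h_E scale_numerals algebra_simps)
qed

text \<open>The right-hand side is twice the Casimir, hh + 2(ef + fe) - xy + yx, in normal order:
  exchanging f and e gives -2 D(h), exchanging y and x gives D(h). In the present scaling (E 2)(-1)
  f is -4 times e(-1) f. The term -2 T(-1) E (-2) of \<open>f\<close> produces 2T, and all else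
  cancels.\<close>

lemma T_expression: "2 \<cdot> T = h\<langle>-1\<rangle> h - h\<langle>-2\<rangle> \<one> - (E 2)\<langle>-1\<rangle> f - 2 \<cdot> (x\<langle>-1\<rangle> y)"
proof -
  have h_minus1_E: "h\<langle>-1\<rangle> E s = (E s)\<langle>-1\<rangle> h + (of_int s * of_int s) \<cdot> (\<kappa>\<langle>-1\<rangle> E s)" for s
    using h_generators(5)[of "-1" s "-1" "E 0"] nprod_E_0[of h] by simp
  have "h\<langle>-1\<rangle> h = h\<langle>-1\<rangle> \<beta>\<langle>-1\<rangle> E 1 - (h\<langle>-1\<rangle> \<kappa>\<langle>-1\<rangle> E 0)"
    by (subst (2) h_def) (simp only: nprod_simps)
  also have "\<dots> = \<beta>\<langle>-1\<rangle> h\<langle>-1\<rangle> E 1 - \<beta>\<langle>-2\<rangle> E 1 + (E (-1))\<langle>-3\<rangle> E 1 - \<kappa>\<langle>-1\<rangle> h"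
    by (simp add: h_generators nprod_E_0[of h])
  also have "\<dots> = (\<beta>\<langle>-1\<rangle> \<beta>\<langle>-1\<rangle> E 2) - \<beta>\<langle>-2\<rangle> E 1 - (\<beta>\<langle>-1\<rangle> \<kappa>\<langle>-1\<rangle> E 1) - \<kappa>\<langle>-2\<rangle> E 0
      + 2 \<cdot> (\<kappa>\<langle>-1\<rangle> \<kappa>\<langle>-1\<rangle> E 0)"
    by (simp add: h_minus1_E) (simp add: h_def half_add_half scale_numerals algebra_simps)
  finally have hh: "h\<langle>-1\<rangle> h = \<dots>" .
  have dh: "h\<langle>-2\<rangle> \<one> = \<beta>\<langle>-2\<rangle> E 1 + (\<beta>\<langle>-1\<rangle> \<kappa>\<langle>-1\<rangle> E 1) - \<kappa>\<langle>-2\<rangle> E 0"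
    by (simp add: h_def composite_nprod[OF even(3)] composite_nprod[OF even(2)])
  have xy: "x\<langle>-1\<rangle> y = - (\<rho>\<langle>-1\<rangle> \<Psi>\<langle>-1\<rangle> E 0) - (\<Psi>\<langle>-1\<rangle> \<Psi>\<langle>-2\<rangle> E 0)
      + (\<beta>\<langle>-1\<rangle> \<kappa>\<langle>-1\<rangle> E 1) - \<kappa>\<langle>-2\<rangle> E 0"
    by (simp add: y_def x_generators x_E half_add_half scale_numerals algebra_simps)
  have ef: "(E 2)\<langle>-1\<rangle> f = (\<beta>\<langle>-1\<rangle> \<beta>\<langle>-1\<rangle> E 2) - 4 \<cdot> (\<beta>\<langle>-1\<rangle> \<kappa>\<langle>-1\<rangle> E 1) - 2 \<cdot> (\<beta>\<langle>-2\<rangle> E 1)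
      + 2 \<cdot> (\<kappa>\<langle>-2\<rangle> E 0) + 2 \<cdot> (\<kappa>\<langle>-1\<rangle> \<kappa>\<langle>-1\<rangle> E 0) + 2 \<cdot> (\<rho>\<langle>-1\<rangle> \<Psi>\<langle>-1\<rangle> E 0)
      + 2 \<cdot> (\<Psi>\<langle>-1\<rangle> \<Psi>\<langle>-2\<rangle> E 0) - 2 \<cdot> (T\<langle>-1\<rangle> E 0)"
    by (simp add: f_def scale_numerals algebra_simps)
  show ?thesis
    unfolding hh dh xy ef
    by (simp add: nprod_E_0[of T] scale_numerals algebra_simps)
qed

section \<open>Supercommutators of the modes of the osp(1,2) fields\<close>

lemma f_even: "f \<in> part V False"
  using nprod_parity[OF y_odd y_odd, of 0] by (simp add: y_y)

lemma x_x_comm: "x\<langle>m\<rangle> x\<langle>n\<rangle> v = - (x\<langle>n\<rangle> x\<langle>m\<rangle> v) + (E 2)\<langle>m + n\<rangle> v"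
  by (subst commutator_trunc[OF x_odd x_odd]) (simp_all add: x_x psign_def)

lemma x_y_comm: "x\<langle>m\<rangle> y\<langle>n\<rangle> v = - (y\<langle>n\<rangle> x\<langle>m\<rangle> v) + h\<langle>m + n\<rangle> v
    - (if m + n = 0 then 3 * of_int m else 0) \<cdot> v"
  by (subst commutator_trunc[OF x_odd y_odd]) (simp_all add: x_y psign_def mult.commute)

lemma y_y_comm: "y\<langle>m\<rangle> y\<langle>n\<rangle> v = - (y\<langle>n\<rangle> y\<langle>m\<rangle> v) + f\<langle>m + n\<rangle> v"
  by (subst commutator_trunc[OF y_odd y_odd]) (simp_all add: y_y psign_def)

lemma h_x_comm: "h\<langle>m\<rangle> x\<langle>n\<rangle> v = x\<langle>n\<rangle> h\<langle>m\<rangle> v + x\<langle>m + n\<rangle> v"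
  by (subst commutator_trunc[OF h_even x_odd]) (simp_all add: h_x psign_def)

lemma h_y_comm: "h\<langle>m\<rangle> y\<langle>n\<rangle> v = y\<langle>n\<rangle> h\<langle>m\<rangle> v - y\<langle>m + n\<rangle> v"
  by (subst commutator_trunc[OF h_even y_odd]) (simp_all add: h_y psign_def)

lemma h_h_comm: "h\<langle>m\<rangle> h\<langle>n\<rangle> v = h\<langle>n\<rangle> h\<langle>m\<rangle> v - (if m + n = 0 then 3 * of_int m else 0) \<cdot> v"
  by (subst commutator_trunc[OF h_even h_even]) (simp_all add: h_h psign_def mult.commute)

lemma e_e_comm: "(E s)\<langle>m\<rangle> (E u)\<langle>n\<rangle> v = (E u)\<langle>n\<rangle> (E s)\<langle>m\<rangle> v"
  by (subst commutator_trunc[OF even(4) even(4)]) (simp_all add: psign_def)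

lemma e_y_comm: "(E 2)\<langle>m\<rangle> y\<langle>n\<rangle> v = y\<langle>n\<rangle> (E 2)\<langle>m\<rangle> v - 2 \<cdot> (x\<langle>m + n\<rangle> v)"
  by (simp add: y_generators(4) x_def)

text \<open>This is how the super Jacobi identity is applied: every bracket with \<open>f\<close>
  reduces to brackets with y.\<close>

lemma f_modes: "f\<langle>m\<rangle> v = y\<langle>0\<rangle> y\<langle>m\<rangle> v + y\<langle>m\<rangle> y\<langle>0\<rangle> v"
  using y_y_comm[of 0 m v] by (simp add: algebra_simps)

text \<open>The super Jacobi identity for \<open>y\<close> alone forces \<open>f\<langle>0\<rangle> y = 2 \<cdot> (y\<langle>0\<rangle> f)\<close>, and skew-symmetry
  gives \<open>f\<langle>0\<rangle> y = - (y\<langle>0\<rangle> f)\<close>.\<close>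

lemma f_y_comm: "f\<langle>m\<rangle> y\<langle>n\<rangle> v = y\<langle>n\<rangle> f\<langle>m\<rangle> v"
proof -
  have pos: "f\<langle>j\<rangle> y = 0" if "j \<ge> 1" for j
    using that by (simp add: f_modes y_y y_f)
  have comm: "f\<langle>m\<rangle> y\<langle>n\<rangle> v = y\<langle>n\<rangle> f\<langle>m\<rangle> v + (f\<langle>0\<rangle> y)\<langle>m + n\<rangle> v" for m n v
    by (subst commutator_trunc[OF f_even y_odd]) (simp_all add: pos psign_def)
  have "f\<langle>0\<rangle> y = 2 \<cdot> (y\<langle>0\<rangle> f)"
    by (simp add: f_modes y_y scale_numerals)
  moreover have "f\<langle>0\<rangle> y = - (y\<langle>0\<rangle> f)"
    using comm[of "-1" 0 "E 0"] by (simp add: nprod_E_0 nprod_E_0_nonneg eq_neg_iff_add_eq_0 add.commute)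
  ultimately have "3 \<cdot> (y\<langle>0\<rangle> f) = 0"
    by (metis add.left_inverse scale_numerals)
  then have "f\<langle>0\<rangle> y = 0"
    using \<open>f\<langle>0\<rangle> y = - (y\<langle>0\<rangle> f)\<close> by simp
  with comm show ?thesis
    by simp
qed

lemma h_e_comm: "h\<langle>m\<rangle> (E 2)\<langle>n\<rangle> v = (E 2)\<langle>n\<rangle> h\<langle>m\<rangle> v + 2 \<cdot> ((E 2)\<langle>m + n\<rangle> v)"
  by (simp add: h_generators(5) add.commute)

lemma f_x_comm: "f\<langle>m\<rangle> x\<langle>n\<rangle> v = x\<langle>n\<rangle> f\<langle>m\<rangle> v + 2 \<cdot> (y\<langle>m + n\<rangle> v)"
  unfolding f_modes by (simp add: x_y_comm h_y_comm scale_numerals algebra_simps)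

lemma h_f_comm: "h\<langle>m\<rangle> f\<langle>n\<rangle> v = f\<langle>n\<rangle> h\<langle>m\<rangle> v - 2 \<cdot> (f\<langle>m + n\<rangle> v)"
  using y_y_comm[of m n v]
  by (simp add: f_modes[of n] h_y_comm) (simp add: f_modes y_y_comm[of n m] scale_numerals algebra_simps)

lemma e_f_comm: "(E 2)\<langle>m\<rangle> f\<langle>n\<rangle> v = f\<langle>n\<rangle> (E 2)\<langle>m\<rangle> v - 4 \<cdot> (h\<langle>m + n\<rangle> v)
    + (if m + n = 0 then 6 * of_int m else 0) \<cdot> v"
  unfolding f_modes by (simp add: e_y_comm x_y_comm scale_numerals algebra_simps)

lemma f_f_comm: "f\<langle>m\<rangle> f\<langle>n\<rangle> v = f\<langle>n\<rangle> f\<langle>m\<rangle> v"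
  by (simp add: f_modes[of n] f_y_comm)

definition osp_field :: "osp \<Rightarrow> 'a" where
  "osp_field a = (case a of Oe \<Rightarrow> (1 / 2) \<cdot> E 2 | Of \<Rightarrow> (- 1 / 2) \<cdot> f | Oh \<Rightarrow> h | Ox \<Rightarrow> x | Oy \<Rightarrow> y)"

lemma osp_field_parity: "osp_field a \<in> part V (osp_odd a)"
  using x_odd y_odd h_even vs.subspace_scale[OF part_subspace even(4)]
    vs.subspace_neg[OF part_subspace vs.subspace_scale[OF part_subspace f_even]]
  by (cases a) (simp_all add: osp_field_def)

text \<open>Each pair of fields has been computed in one order; the other order is the same identity
  with m and n exchanged, and \<open>swap\<close> adjusts the sign of the central term.\<close>

lemma osp_relations:
  assumes "k = - 3 / 2"
  shows "(osp_field a)\<langle>m\<rangle> (osp_field b)\<langle>n\<rangle> v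
    = psign (osp_odd a) (osp_odd b) \<cdot> ((osp_field b)\<langle>n\<rangle> (osp_field a)\<langle>m\<rangle> v)
      + (\<Sum>c\<in>UNIV. osp_bracket a b c \<cdot> ((osp_field c)\<langle>m + n\<rangle> v))
      + (if m + n = 0 then of_int m * osp_form a b * k else 0) \<cdot> v"
proof -
  have UNIV_osp: "(UNIV :: osp set) = {Oe, Of, Oh, Ox, Oy}"
    using osp.exhaust by blast
  have sum: "(\<Sum>c\<in>UNIV. g c) = g Oe + g Of + g Oh + g Ox + g Oy" for g :: "osp \<Rightarrow> 'a"
    by (subst UNIV_osp) (simp add: add.assoc)
  have swap: "m + n = 0 \<Longrightarrow> n = - m"
    by simp
  note comms = x_x_comm[of m n v] x_y_comm[of m n v] x_y_comm[of n m v] y_y_comm[of m n v]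
    h_x_comm[of m n v] h_x_comm[of n m v] h_y_comm[of m n v] h_y_comm[of n m v] h_h_comm[of m n v]
    e_e_comm[of 2 m 2 n v] x_generators(5)[of m 2 n v] x_generators(5)[of n 2 m v]
    e_y_comm[of m n v] e_y_comm[of n m v] h_e_comm[of m n v] h_e_comm[of n m v]
    e_f_comm[of m n v] e_f_comm[of n m v] f_x_comm[of m n v] f_x_comm[of n m v]
    h_f_comm[of m n v] h_f_comm[of n m v] f_y_comm[of m n v] f_y_comm[of n m v] f_f_comm[of m n v]
  show ?thesis
    unfolding sum using assms
    by (cases a; cases b)
       (simp_all add: osp_field_def psign_def comms add.commute[of n m] swap vs.scale_minus_left)
qed

section \<open>Consequences for a homomorphism with these values on the generators\<close>

lemma hom_image_contains_T:
  assumes hom: "vsa_hom U V \<Phi>" and J: "\<And>a. \<Phi> (J a) = osp_field a"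
  shows "T \<in> range \<Phi>"
proof -
  interpret U: vertex_superalgebra U
    using hom by (simp add: vsa_hom_def)
  interpret \<Phi>: module_hom "smult U" "smult V" \<Phi>
    using hom by (simp add: vsa_hom_def module_hom_iff_linear)
  have \<Phi>: "\<Phi> (nprod U u n w) = (\<Phi> u)\<langle>n\<rangle> \<Phi> w" "\<Phi> (vac U) = \<one>" for u n w
    using hom by (simp_all add: vsa_hom_def)
  \<comment> \<open>A preimage of 2T modelled on \<open>T_expression\<close>. The coefficient 4
    undoes the factors 1/2 and -1/2 in \<open>osp_field\<close>.\<close>
  define w where "w = nprod U (J Oh) (-1) (J Oh) - nprod U (J Oh) (-2) (vac U)
    + smult U 4 (nprod U (J Oe) (-1) (J Of)) - smult U 2 (nprod U (J Ox) (-1) (J Oy))"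
  have "\<Phi> w = 2 \<cdot> T"
    unfolding T_expression w_def
    by (simp add: \<Phi> J \<Phi>.add \<Phi>.diff \<Phi>.scale osp_field_def del: vac_E)
  then have "\<Phi> (smult U (1 / 2) w) = T"
    by (simp add: \<Phi>.scale)
  then show ?thesis
    by (metis rangeI)
qed

text \<open>Were x a multiple of the vacuum, x(1)y would vanish, but it is -3 times the
  vacuum.\<close>

lemma hom_nontrivial:
  assumes "\<one> \<noteq> 0" and J: "\<And>a. \<Phi> (J a) = osp_field a"
  shows "nontrivial_hom V \<Phi>"
proof -
  have "x \<notin> range (\<lambda>s. s \<cdot> \<one>)"
  proof
    assume "x \<in> range (\<lambda>s. s \<cdot> \<one>)"
    then obtain s where "x = s \<cdot> \<one>"
      by blast
    then have "x\<langle>1\<rangle> y = 0"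
      by (simp del: vac_E)
    with x_y[of 1] \<open>\<one> \<noteq> 0\<close> show False
      by (simp del: vac_E)
  qed
  moreover have "x \<in> range \<Phi>"
    using J[of Ox] rangeI[of \<Phi> "J Ox"] by (simp add: osp_field_def)
  ultimately show ?thesis
    unfolding nontrivial_hom_def by blast
qed

lemma T_central:
  assumes "T \<in> S"
  shows "central_in V S T"
  unfolding central_in_def
proof (intro conjI exI[of _ "\<lambda>p. if p then 0 else T"] allI ballI)
  show "(if p then 0 else T) \<in> part V p" for p
    using even(1) vs.subspace_0[OF part_subspace] by simp
qed (use assms in \<open>simp_all add: T_comm psign_def\<close>)

end

section \<open>The homomorphism\<close>

lemma vsa_hom_part:
  assumes "vsa_hom V W f" "a \<in> part V p"
  shows "f a \<in> part W p"
proof -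
  have "f ` part V p \<subseteq> part W p"
    using assms(1) by (simp add: vsa_hom_def)
  then show ?thesis
    using assms(2) by blast
qed

lemma vsa_hom_compose:
  assumes "vsa_hom U V f" "vsa_hom V W g"
  shows "vsa_hom U W (\<lambda>u. g (f u))"
proof -
  have "module_hom (smult U) (smult W) (g \<circ> f)"
    using assms by (intro module_hom_compose) (auto simp: vsa_hom_def module_hom_iff_linear)
  moreover have "(\<lambda>u. g (f u)) ` part U p \<subseteq> part W p" for p
    using assms by (auto intro: vsa_hom_part)
  ultimately show ?thesis
    using assms by (simp add: vsa_hom_def module_hom_iff_linear o_def)
qed

lemma Vns_crit_facts:
  assumes "is_Vns_crit N G T"
  shows "vertex_superalgebra N" "G \<in> part N True" "T \<in> part N False" "vac N \<noteq> 0"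
    and "n \<ge> 0 \<Longrightarrow> nprod N T n v = 0"
    and "n \<ge> 0 \<Longrightarrow> nprod N G n G =
      (if n = 0 then smult N 2 T else if n = 2 then smult N (-2) (vac N) else 0)"
proof -
  have free: "freely_generated N [(True, G), (False, T)]"
    and central: "central_in N UNIV T"
    and bracket: "lambda_bracket N G G =
      (\<lambda>j. if j = 0 then smult N 2 T else if j = 2 then smult N (-1) (vac N) else 0)"
    using assms by (simp_all add: is_Vns_crit_def)
  show N: "vertex_superalgebra N" and G: "G \<in> part N True" and T: "T \<in> part N False"
    using free by (simp_all add: freely_generated_def)
  interpret vertex_superalgebra N
    by (rule N)
  have "[] \<in> pbw_words [(True, G), (False, T)]"
    by (simp add: pbw_words_def)
  then have "pbw_monomial N [(True, G), (False, T)] [] \<in>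
      pbw_monomial N [(True, G), (False, T)] ` pbw_words [(True, G), (False, T)]"
    by (rule imageI)
  then have "vac N \<in> pbw_monomial N [(True, G), (False, T)] ` pbw_words [(True, G), (False, T)]"
    by (simp only: pbw_monomial_def foldr.simps id_apply)
  moreover have "\<not> vs.dependent (pbw_monomial N [(True, G), (False, T)] ` pbw_words [(True, G), (False, T)])"
    using free by (simp add: freely_generated_def basis_family_def)
  ultimately show "vac N \<noteq> 0"
    by (metis vs.dependent_zero)
  obtain z where z: "T = z False + z True" "\<And>p. z p \<in> part N p"
    "\<And>p q a v m n. a \<in> part N q \<Longrightarrow>
      nprod N (z p) m (nprod N a n v) = smult N (psign p q) (nprod N a n (nprod N (z p) m v))"
    using central unfolding central_in_def by blast
  \<comment> \<open>As T is even, its odd component lies in both parts and is therefore 0.\<close>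
  have "z True = T - z False"
    using z(1) by simp
  then have "z True \<in> part N False \<inter> part N True"
    using vs.subspace_diff[OF part_subspace T z(2)[of False]] z(2)[of True] by simp
  then have "T = z False"
    using part_disjoint z(1) by simp
  \<comment> \<open>Centrality is applied to a = a(-1)1: the mode T(n) passes a(-1) and kills the
    vacuum.\<close>
  then have "nprod N T n a = 0" if "a \<in> part N q" "n \<ge> 0" for n a q
    using z(3)[OF that(1), of False n "-1" "vac N"] that(2) by simp
  moreover obtain v0 v1 where "v = v0 + v1" "v0 \<in> part N False" "v1 \<in> part N True"
    by (rule homogeneous_cases)
  ultimately show "nprod N T n v = 0" if "n \<ge> 0"
    using that by simp
  show "nprod N G n G = (if n = 0 then smult N 2 T else if n = 2 then smult N (-2) (vac N) else 0)"
    if "n \<ge> 0"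
  proof -
    obtain j where j: "n = int j"
      using zero_le_imp_eq_int[OF \<open>n \<ge> 0\<close>] by blast
    \<comment> \<open>\<open>lambda_bracket\<close> divides by j!, so the coefficient -1 of
      \<lambda>^2 turns into the product -2.\<close>
    have "nprod N G (int j) G = smult N (fact j) (lambda_bracket N G G j)"
      by (simp add: lambda_bracket_def)
    then show ?thesis
      unfolding j bracket by (auto simp: numeral_2_eq_2)
  qed
qed

text \<open>The anticommutator of the modes n and -1 of \<Psi> is applied to the vacuum.\<close>

lemma fermionic_self_products:
  assumes "is_fermionic F \<Psi>" "n \<ge> 0"
  shows "nprod F \<Psi> n \<Psi> = (if n = 0 then vac F else 0)"
proof -
  interpret vertex_superalgebra F
    using assms(1) by (simp add: is_fermionic_def)
  have "nprod F \<Psi> n (nprod F \<Psi> (-1) (vac F)) + nprod F \<Psi> (-1) (nprod F \<Psi> n (vac F))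
      = (if n + -1 + 1 = 0 then vac F else 0)"
    using assms(1) unfolding is_fermionic_def by blast
  then show ?thesis
    using assms(2) by simp
qed

theorem theorem1p2:
  fixes k :: complex
    and V :: "'v::ab_group_add vsa" and J :: "osp \<Rightarrow> 'v"
    and N :: "'n::ab_group_add vsa" and G T :: 'n
    and F :: "'f::ab_group_add vsa" and \<Psi> :: 'f
    and P :: "'p::ab_group_add vsa" and c d :: 'p and E :: "int \<Rightarrow> 'p"
    and NF :: "'nf::ab_group_add vsa" and tNF :: "'n \<Rightarrow> 'f \<Rightarrow> 'nf"
    and W :: "'w::ab_group_add vsa" and tW :: "'nf \<Rightarrow> 'p \<Rightarrow> 'w"
  assumes "k = - 3 / 2"
    and "universal_affine osp_odd osp_bracket osp_form k V J"
    and "is_Vns_crit N G T"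
    and "is_fermionic F \<Psi>"
    and "is_Pi_half P c d E"
    and "tensor_product N F NF tNF"
    and "tensor_product NF P W tW"
  shows "\<exists>\<Phi> :: 'v \<Rightarrow> 'w. vsa_hom V W \<Phi> \<and> nontrivial_hom W \<Phi> \<and>
           tW (tNF T (vac F)) (vac P) \<in> range \<Phi> \<and>
           central_in W (range \<Phi>) (tW (tNF T (vac F)) (vac P))"
proof -
  note N_facts = Vns_crit_facts[OF assms(3)]
  interpret N: vertex_superalgebra N
    by (rule N_facts)
  interpret F: vertex_superalgebra F
    using assms(4) by (simp add: is_fermionic_def)
  have "vertex_superalgebra P"
    using assms(5) by (simp add: is_Pi_half_def)
  then interpret P: lattice_vsa P c d E
    using assms(5) by (simp add: lattice_vsa_def lattice_vsa_axioms_def)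
  interpret NF: vsa_tensor N F NF tNF
    by unfold_locales (rule assms(6))
  interpret W: vsa_tensor NF P W tW
    by unfold_locales (rule assms(7))
  define iN where "iN a = W.inl (NF.inl a)" for a
  define iF where "iF b = W.inl (NF.inr b)" for b
  have iN: "vsa_hom N W iN" and iF: "vsa_hom F W iF"
    unfolding iN_def[abs_def] iF_def[abs_def]
    by (rule vsa_hom_compose[OF NF.inl_hom W.inl_hom] vsa_hom_compose[OF NF.inr_hom W.inl_hom])+
  note homs = iN iF W.inr_hom
  have linear: "module_hom (smult N) (smult W) iN" "module_hom (smult F) (smult W) iF"
    "module_hom (smult P) (smult W) W.inr"
    using homs by (simp_all add: vsa_hom_def module_hom_iff_linear)
  have nprod_hom: "nprod W (iN a) n (iN b) = iN (nprod N a n b)"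
    "nprod W (iF p) n (iF q) = iF (nprod F p n q)"
    "nprod W (W.inr u) n (W.inr v) = W.inr (nprod P u n v)" for a b p q u v n
    using homs by (simp_all add: vsa_hom_def)
  have vac_hom: "iN (vac N) = vac W" "iF (vac F) = vac W" "W.inr (vac P) = vac W"
    using homs by (simp_all add: vsa_hom_def)
  have part_hom: "a \<in> part N p \<Longrightarrow> iN a \<in> part W p" "b \<in> part F p \<Longrightarrow> iF b \<in> part W p"
    "u \<in> part P p \<Longrightarrow> W.inr u \<in> part W p" for a b u p
    by (fact homs[THEN vsa_hom_part])+
  \<comment> \<open>The earlier tensor factor stands on the left, so its nonnegative mode meets a
    vacuum in its own factor.\<close>
  have mixed: "nprod W (iN a) n (iF b) = 0" "nprod W (iN a) n (W.inr u) = 0"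
    "nprod W (iF b) n (W.inr u) = 0" if "n \<ge> 0" for a b u n
  proof -
    have "nprod W (iN a) n (iF b) = W.inl (nprod NF (NF.inl a) n (NF.inr b))"
      using W.inl_hom by (simp add: iN_def iF_def vsa_hom_def)
    then show "nprod W (iN a) n (iF b) = 0"
      using NF.inl_nprod_inr[OF that] by (simp add: W.inl_def)
    show "nprod W (iN a) n (W.inr u) = 0" "nprod W (iF b) n (W.inr u) = 0"
      using W.inl_nprod_inr[OF that] by (simp_all add: iN_def iF_def)
  qed
  have T_annihilates: "nprod W (iN T) n w = 0" if "n \<ge> 0" for n w
    unfolding iN_def using that by (intro W.inl_annihilates NF.inl_annihilates N_facts(5))
  interpret CF: critical_fields W "iN (smult N \<i> G)" "iF \<Psi>" "iN T" "W.inr P.\<kappa>" "W.inr P.\<beta>" "\<lambda>s. W.inr (E s)"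
  proof
    show "iN (smult N \<i> G) \<in> part W True" "iF \<Psi> \<in> part W True" "iN T \<in> part W False"
      using N_facts(2,3) assms(4) N.vs.subspace_scale[OF N.part_subspace]
      by (auto intro!: part_hom simp: is_fermionic_def)
    show "W.inr P.\<kappa> \<in> part W False"
      by (rule part_hom(3)) (rule P.even)
  next
    fix n :: int assume n: "n \<ge> 0"
    show "nprod W (iN (smult N \<i> G)) n (iN (smult N \<i> G))
        = (if n = 0 then smult W (- 2) (iN T) else if n = 2 then smult W 2 (vac W) else 0)"
      using n by (simp add: nprod_hom N_facts(6) module_hom.scale[OF linear(1)]
          module_hom.zero[OF linear(1)] module_hom.neg[OF linear(1)] vac_hom)
    show "nprod W (iF \<Psi>) n (iF \<Psi>) = (if n = 0 then vac W else 0)"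
      using n by (simp add: nprod_hom fermionic_self_products[OF assms(4)] vac_hom
          module_hom.zero[OF linear(2)])
  qed (simp_all add: part_hom mixed T_annihilates nprod_hom vac_hom P.\<beta>_\<beta> P.\<beta>_E P.c_\<beta> P.c_c_nonneg
      module_hom.zero[OF linear(3)] module_hom.scale[OF linear(3)] module_hom.add[OF linear(3)]
      P.E_nprod_E_minus2 P.E_nprod_E_minus3)
  obtain \<Phi> where \<Phi>: "vsa_hom V W \<Phi>" "\<And>a. \<Phi> (J a) = CF.osp_field a"
    using affine_hom_exists[OF assms(2) W.W.vertex_superalgebra_axioms CF.osp_field_parity
        CF.osp_relations[OF assms(1)]]
    by blast
  have T: "tW (tNF T (vac F)) (vac P) = iN T"
    by (simp add: iN_def W.inl_def NF.inl_def)
  have F_vac: "vac F \<noteq> 0"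
    using assms(4) by (simp add: is_fermionic_def)
  \<comment> \<open>Nontriviality rests on this, as x is detected by x(1)y, a multiple of the
    vacuum. The three vacua are nonzero, and tensors of nonzero vectors are nonzero.\<close>
  have "vac W \<noteq> 0"
    using W.t_nonzero[OF NF.t_nonzero[OF N_facts(4) F_vac] P.vac_nonzero]
    unfolding NF.t_vac W.t_vac .
  then have "nontrivial_hom W \<Phi>"
    by (rule CF.hom_nontrivial) (rule \<Phi>(2))
  moreover have "iN T \<in> range \<Phi>"
    using CF.hom_image_contains_T[OF \<Phi>] .
  ultimately show ?thesis
    unfolding T using \<Phi>(1) CF.T_central by blast
qed

end
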